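(* (Second law of thermodynamics) Consider a thermal system in a Euclidean $*$-algebra $\mathbb{E}$ with Hermitian extensive variables $H$ and $X_j$ ($j\in J$), with Hamilton potential $$U(\overline S,\overline X):=\max_{T,\alpha}\{T\overline S+\alpha\cdot\overline X\mid\Delta(T,\alpha)=0,\ T>0\}$$ and Helmholtz potential $$A(T,\overline X):=\max_\alpha\{\alpha\cdot\overline X\mid\Delta(T,\alpha)=0\}.$$ (i) In an arbitrary (Gibbs) state, $\overline H\ge U(\overline S,\overline X)$, with equality iff the state is a thermal state of positive temperature. The remaining thermal variables are then given by $$T=\frac{\partial U}{\partial\overline S}(\overline S,\overline X),\qquad\alpha=\frac{\partial U}{\partial\overline X}(\overline S,\overline X),\qquad U=\overline H=U(\overline S,\overline X).$$ In particular, a thermal state of positive temperature is uniquely determined by the values of $\overline S$ and $\overline X$. (ii) Let $T>0$. Then, in an arbitrary (Gibbs) state, $\overline H-T\overline S\ge A(T,\overline X)$, with equality iff the state is a thermal state of temperature $T$. The remaining thermal variables are then given by $$\overline S=-\frac{\partial A}{\partial T}(T,\overline X),\qquad\alpha=\frac{\partial A}{\partial\overline X}(T,\overline X),\qquad\overline H=T\overline S+\alpha\cdot\overline X=A(T,\overline X)+T\overline S.$$ In particular, a thermal state of positive temperature is uniquely determined by the values of $T$ and $\overline X$.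
   Context: A Euclidean $*$-algebra $\mathbb{E}$ (finite- or infinite-dimensional) is an associative complex algebra (elements are called quantities) containing the complex numbers as constants, with an involution $*$ (conjugate-linear, $(gh)^*=h^*g^*$, $g^{**}=g$, reducing to complex conjugation on constants) and a complex-valued linear integral $\int$ defined on a subspace of strongly integrable quantities (possibly extended to a larger class of integrable quantities). One writes $g\ge0$ iff $g^*=g$ and $\int h^*gh\ge0$ for all strongly integrable $h$, and $g\ge h$ iff $g-h\ge0$; $g$ is Hermitian if $g^*=g$, and bounded if $g^*g\le a^2$ for some $a\in\mathbb{R}$. For bounded $g$ and strongly integrable $h,h_l$ one assumes: (EA1) $h^*,gh,hg$ are strongly integrable; (EA2) $(\int h)^*=\int h^*$, $\int gh=\int hg$; (EA3) $\int h^*h>0$ if $h\ne0$; (EA4) $\int h^*gh=0$ for all strongly integrable $h$ implies $g=0$; (EA5) $\int h_l^*h_l\to0$ implies $\int gh_l\to0$ and $\int h_l^*gh_l\to0$; (EA6) $h_l\downarrow0$ implies $\inf\int h_l=0$, where $h_l\downarrow0$ means that for every strongly integrable $h$ the numbers $\int h^*h_lh$ are real and decrease monotonically to $0$. Examples: $\mathbb{C}^{N\times N}$ with conjugate transpose and trace; algebras of functions on phase space with the Liouville integral; algebras of operators on a dense subspace of a Hilbert space with the trace. The usual calculus rules for functions of quantities are assumed to hold (they are automatic in finite dimension): $e^{af}e^{bf}=e^{(a+b)f}$ for real $a,b$; $(e^f)^*=e^{f^*}$; $e^fg=ge^f$ if $f,g$ commute; $\log e^f=f$ for Hermitian $f$;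 every $f\ge0$ has a square root $\sqrt f\ge0$ with $(\sqrt f)^2=f$; $\int$ may be interchanged with integration over a real parameter and with differentiation with respect to parameters; $\frac{d}{d\lambda}\int F(f)=\int F'(f)\frac{df}{d\lambda}$, and the analogous chain rule for functions of two commuting quantities. Let $k$ be the Boltzmann constant. A Gibbs state is a mapping $\langle g\rangle:=\int e^{-S/k}g$, where the entropy $S$ is a Hermitian quantity with strongly integrable $e^{-S/k}$ and $\int e^{-S/k}=1$. A thermal system is defined by a family of Hermitian quantities $H$ and $X_j$ ($j\in J$, $J$ finite), with $X=(X_j)_{j\in J}$ and $\alpha\cdot X=\sum_j\alpha_jX_j$. A thermal state is a Gibbs state whose entropy has the form $S=T^{-1}(H-\alpha\cdot X)$ with real $T\ne0$ (the temperature) and $\alpha\in\mathbb{R}^J$. The system function is $\Delta(T,\alpha)=\kappa T\log\int e^{-(H-\alpha\cdot X)/(kT)}$ with a fixed $\kappa>0$; only regions where it is twice continuously differentiable are considered. Bars denote values: for a Gibbs state with entropy $S$, $\overline H=\langle H\rangle$, $\overline S=\langle S\rangle$, $\overline X=(\langle X_j\rangle)_{j\in J}$. The thermal variables are $\overline S,\overline H,\overline X,T,\alpha$. In the definitions of the potentials the arguments are arbitrary real values. $U$ without arguments denotes the internal energy $T\overline S+\alpha\cdot\overline X$.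
   Formalization: The derivative formulas are proved wherever the partial derivatives exist; their existence is proved when Δ is C² near (T,α), H and the X_j are linearly independent and, for ∂A/∂T, X̄≠0, since otherwise they can fail to exist. The values of H, S and X_j are assumed to exist. *)

theory Defs
  imports "HOL-Analysis.Analysis"
begin

section \<open>Euclidean *-algebras\<close>

text \<open>
  The algebra is a ring with unit together with an embedding \<open>cst\<close> of the complex numbers as
  central constants; scalar multiplication by \<open>c\<close> is multiplication by \<open>cst c\<close>.
  \<open>SI\<close> is the space of strongly integrable quantities and \<open>Intg\<close> the larger space of
  integrable quantities to which the integral is extended; \<open>integ\<close> has no meaning outside \<open>Intg\<close>.
\<close>

record 'e star_algebra =
  cst :: "complex \<Rightarrow> 'e"
  adj :: "'e \<Rightarrow> 'e"
  SI :: "'e set"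
  Intg :: "'e set"
  integ :: "'e \<Rightarrow> complex"
  qexp :: "'e \<Rightarrow> 'e"
  qlog :: "'e \<Rightarrow> 'e"

definition rscale :: "('e::ring_1, 'm) star_algebra_scheme \<Rightarrow> real \<Rightarrow> 'e \<Rightarrow> 'e" where
  "rscale A r g = cst A (complex_of_real r) * g"

definition hermitian :: "('e, 'm) star_algebra_scheme \<Rightarrow> 'e \<Rightarrow> bool" where
  "hermitian A g \<longleftrightarrow> adj A g = g"

text \<open>\<open>g \<ge> 0\<close>; that the integrals in question exist is part of the condition.\<close>
definition qnonneg :: "('e::ring_1, 'm) star_algebra_scheme \<Rightarrow> 'e \<Rightarrow> bool" where
  "qnonneg A g \<longleftrightarrow> adj A g = g \<and>
     (\<forall>h\<in>SI A. adj A h * g * h \<in> Intg A \<and> integ A (adj A h * g * h) \<in> \<real>\<^sub>\<ge>\<^sub>0)"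

definition qge :: "('e::ring_1, 'm) star_algebra_scheme \<Rightarrow> 'e \<Rightarrow> 'e \<Rightarrow> bool" where
  "qge A g h \<longleftrightarrow> qnonneg A (g - h)"

definition qbounded :: "('e::ring_1, 'm) star_algebra_scheme \<Rightarrow> 'e \<Rightarrow> bool" where
  "qbounded A g \<longleftrightarrow> (\<exists>a::real. qge A (cst A (complex_of_real (a\<^sup>2))) (adj A g * g))"

definition square_integrable :: "('e::ring_1, 'm) star_algebra_scheme \<Rightarrow> 'e \<Rightarrow> bool" where
  "square_integrable A h \<longleftrightarrow> adj A h * h \<in> Intg A"

text \<open>\<open>h\<^sub>l \<down> 0\<close>\<close>
definition decreases_to_zero ::
  "('e::ring_1, 'm) star_algebra_scheme \<Rightarrow> (nat \<Rightarrow> 'e) \<Rightarrow> bool" where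
  "decreases_to_zero A hs \<longleftrightarrow>
     (\<forall>h\<in>SI A.
        (\<forall>l. adj A h * hs l * h \<in> Intg A \<and> integ A (adj A h * hs l * h) \<in> \<real>) \<and>
        decseq (\<lambda>l. Re (integ A (adj A h * hs l * h))) \<and>
        (\<lambda>l. Re (integ A (adj A h * hs l * h))) \<longlonglongrightarrow> 0)"

text \<open>
  The rules \<open>EA2_ext\<close> and \<open>EA3_ext\<close> say that (EA2) and (EA3) persist for the extended integral
  wherever the integrals involved are defined, and \<open>Intg_mult\<close> that a product of two square
  integrable quantities is integrable.  Without an extension the expectation of an unbounded
  Hamiltonian would not be defined.
\<close>

locale euclidean_star_algebra =
  fixes A :: "('e::ring_1, 'm) star_algebra_scheme"
  assumes cst_1: "cst A 1 = 1"
    and cst_add: "cst A (c + d) = cst A c + cst A d"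
    and cst_mult: "cst A (c * d) = cst A c * cst A d"
    and cst_central: "cst A c * g = g * cst A c"
    and adj_add: "adj A (g + h) = adj A g + adj A h"
    and adj_mult: "adj A (g * h) = adj A h * adj A g"
    and adj_adj: "adj A (adj A g) = g"
    and adj_cst: "adj A (cst A c) = cst A (cnj c)"
    and SI_0: "0 \<in> SI A"
    and SI_add: "\<lbrakk>g \<in> SI A; h \<in> SI A\<rbrakk> \<Longrightarrow> g + h \<in> SI A"
    and SI_scale: "g \<in> SI A \<Longrightarrow> cst A c * g \<in> SI A"
    and SI_subset_Intg: "SI A \<subseteq> Intg A"
    and Intg_add: "\<lbrakk>g \<in> Intg A; h \<in> Intg A\<rbrakk> \<Longrightarrow> g + h \<in> Intg A"
    and Intg_scale: "g \<in> Intg A \<Longrightarrow> cst A c * g \<in> Intg A"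
    and Intg_adj: "g \<in> Intg A \<Longrightarrow> adj A g \<in> Intg A"
    and integ_add: "\<lbrakk>g \<in> Intg A; h \<in> Intg A\<rbrakk> \<Longrightarrow> integ A (g + h) = integ A g + integ A h"
    and integ_scale: "g \<in> Intg A \<Longrightarrow> integ A (cst A c * g) = c * integ A g"
    and integ_adj_ext: "g \<in> Intg A \<Longrightarrow> integ A (adj A g) = cnj (integ A g)"
    and SI_square: "h \<in> SI A \<Longrightarrow> square_integrable A h"
    and Intg_mult: "\<lbrakk>square_integrable A g; square_integrable A h\<rbrakk> \<Longrightarrow>
          adj A g * h \<in> Intg A \<and> h * adj A g \<in> Intg A"
    and EA2_ext: "\<lbrakk>g * h \<in> Intg A; h * g \<in> Intg A\<rbrakk> \<Longrightarrow> integ A (g * h) = integ A (h * g)"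
    and EA3_ext: "\<lbrakk>square_integrable A h; h \<noteq> 0\<rbrakk> \<Longrightarrow>
          integ A (adj A h * h) \<in> \<real> \<and> Re (integ A (adj A h * h)) > 0"
    and EA1: "\<lbrakk>qbounded A g; h \<in> SI A\<rbrakk> \<Longrightarrow> adj A h \<in> SI A \<and> g * h \<in> SI A \<and> h * g \<in> SI A"
    and EA2: "\<lbrakk>qbounded A g; h \<in> SI A\<rbrakk> \<Longrightarrow>
          cnj (integ A h) = integ A (adj A h) \<and> integ A (g * h) = integ A (h * g)"
    and EA3: "\<lbrakk>h \<in> SI A; h \<noteq> 0\<rbrakk> \<Longrightarrow>
          integ A (adj A h * h) \<in> \<real> \<and> Re (integ A (adj A h * h)) > 0"
    and EA4: "\<lbrakk>qbounded A g; \<And>h. h \<in> SI A \<Longrightarrow> integ A (adj A h * g * h) = 0\<rbrakk> \<Longrightarrow> g = 0"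
    and EA5: "\<lbrakk>qbounded A g; \<And>l. hs l \<in> SI A; (\<lambda>l::nat. integ A (adj A (hs l) * hs l)) \<longlonglongrightarrow> 0\<rbrakk> \<Longrightarrow>
          (\<lambda>l. integ A (g * hs l)) \<longlonglongrightarrow> 0 \<and> (\<lambda>l. integ A (adj A (hs l) * g * hs l)) \<longlonglongrightarrow> 0"
    and EA6: "\<lbrakk>\<And>l. hs l \<in> SI A; decreases_to_zero A hs\<rbrakk> \<Longrightarrow>
          (\<forall>l::nat. integ A (hs l) \<in> \<real>) \<and>
          bdd_below (range (\<lambda>l. Re (integ A (hs l)))) \<and> (INF l. Re (integ A (hs l))) = 0"

text \<open>
  The calculus of functions of quantities, as far as it concerns exponentials, logarithms and
  square roots; only functions of Hermitian quantities are involved.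

  In \<open>integ_interchange\<close> and \<open>interpolation\<close> the parameter-dependent quantity is
  \<open>e\<^bsup>(1-t)f\<^esup> e\<^bsup>tg\<^esup>\<close>, whose derivative with respect to \<open>t\<close> is \<open>e\<^bsup>(1-t)f\<^esup> (g - f) e\<^bsup>tg\<^esup>\<close>:
  it is integrable if \<open>e\<^bsup>f\<^esup>\<close> and \<open>e\<^bsup>g\<^esup>\<close> are strongly integrable, and may be differentiated under
  the integral wherever the derivative is integrable.
  \<open>integ_chain\<close> is the rule \<open>d/d\<lambda> \<integral>F(f) = \<integral>F'(f) df/d\<lambda>\<close> for \<open>F = exp\<close> along a line; here \<open>f\<close> and
  \<open>g\<close> need not commute.
\<close>

locale quantity_calculus = euclidean_star_algebra A
  for A :: "('e::ring_1, 'm) star_algebra_scheme" +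
  assumes qexp_cst: "qexp A (cst A (complex_of_real r)) = cst A (complex_of_real (exp r))"
    and qexp_add: "hermitian A f \<Longrightarrow>
          qexp A (rscale A a f) * qexp A (rscale A b f) = qexp A (rscale A (a + b) f)"
    and qexp_adj: "hermitian A f \<Longrightarrow> adj A (qexp A f) = qexp A (adj A f)"
    and qexp_commute: "\<lbrakk>hermitian A f; f * g = g * f\<rbrakk> \<Longrightarrow> qexp A f * g = g * qexp A f"
    and qlog_qexp: "hermitian A f \<Longrightarrow> qlog A (qexp A f) = f"
    and qsqrt: "qnonneg A f \<Longrightarrow> \<exists>r. qnonneg A r \<and> r * r = f"
    and interpolation: "\<lbrakk>hermitian A f; hermitian A g; qexp A f \<in> SI A; qexp A g \<in> SI A;
          0 \<le> t; t \<le> 1\<rbrakk> \<Longrightarrow>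
          qexp A (rscale A (1 - t) f) * qexp A (rscale A t g) \<in> Intg A \<and>
          square_integrable A (qexp A (rscale A ((1 - t) / 2) f) * qexp A (rscale A (t / 2) g))"
    and integ_interchange: "\<lbrakk>hermitian A f; hermitian A g; qexp A f \<in> SI A; qexp A g \<in> SI A;
          0 \<le> t; t \<le> 1;
          qexp A (rscale A (1 - t) f) * (g - f) * qexp A (rscale A t g) \<in> Intg A\<rbrakk> \<Longrightarrow>
          ((\<lambda>u. integ A (qexp A (rscale A (1 - u) f) * qexp A (rscale A u g)))
             has_vector_derivative
             integ A (qexp A (rscale A (1 - t) f) * (g - f) * qexp A (rscale A t g)))
            (at t within {0..1})"
    and integ_chain: "\<lbrakk>hermitian A f; hermitian A g; \<epsilon> > 0;
          \<And>u. \<bar>u\<bar> < \<epsilon> \<Longrightarrow> qexp A (f + rscale A u g) \<in> SI A;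
          (\<lambda>u::real. integ A (qexp A (f + rscale A u g))) differentiable (at 0)\<rbrakk> \<Longrightarrow>
          qexp A f * g \<in> Intg A \<and>
          ((\<lambda>u. integ A (qexp A (f + rscale A u g))) has_vector_derivative
             integ A (qexp A f * g)) (at 0)"

section \<open>Thermal systems\<close>

text \<open>
  The finite index set \<open>J\<close> is an arbitrary, possibly empty, subset \<open>Idx\<close> of a finite type; of a
  vector in \<open>real ^ 'j\<close> only the components in \<open>Idx\<close> matter.
\<close>

record ('e, 'j) thermal = "'e star_algebra" +
  boltz :: real
  kappa :: real
  Ham :: 'e
  Ext :: "'j \<Rightarrow> 'e"
  Idx :: "'j set"

locale thermal_system = quantity_calculus M
  for M :: "('e::ring_1, 'j::finite) thermal" +
  assumes boltz_pos: "boltz M > 0"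
    and kappa_pos: "kappa M > 0"
    and Ham_hermitian: "hermitian M (Ham M)"
    and Ext_hermitian: "j \<in> Idx M \<Longrightarrow> hermitian M (Ext M j)"

definition dens :: "('e::ring_1, 'j::finite) thermal \<Rightarrow> 'e \<Rightarrow> 'e" where
  "dens M S = qexp M (rscale M (- 1 / boltz M) S)"

text \<open>\<open>gibbs_state M S\<close>: the quantity \<open>S\<close> is the entropy of a Gibbs state.\<close>
definition gibbs_state :: "('e::ring_1, 'j::finite) thermal \<Rightarrow> 'e \<Rightarrow> bool" where
  "gibbs_state M S \<longleftrightarrow> hermitian M S \<and> dens M S \<in> SI M \<and> integ M (dens M S) = 1"

definition expect :: "('e::ring_1, 'j::finite) thermal \<Rightarrow> 'e \<Rightarrow> 'e \<Rightarrow> complex" where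
  "expect M S g = integ M (dens M S * g)"

text \<open>\<open>H\<close>, \<open>S\<close> and the \<open>X\<^sub>j\<close> have a value in the state with entropy \<open>S\<close>.\<close>
definition has_values :: "('e::ring_1, 'j::finite) thermal \<Rightarrow> 'e \<Rightarrow> bool" where
  "has_values M S \<longleftrightarrow> dens M S * Ham M \<in> Intg M \<and> dens M S * S \<in> Intg M \<and>
     (\<forall>j\<in>Idx M. dens M S * Ext M j \<in> Intg M)"

text \<open>The values are real by lemma \<open>expect_real\<close> below, so taking the real part loses nothing.\<close>
definition Hbar :: "('e::ring_1, 'j::finite) thermal \<Rightarrow> 'e \<Rightarrow> real" where
  "Hbar M S = Re (expect M S (Ham M))"

definition Sbar :: "('e::ring_1, 'j::finite) thermal \<Rightarrow> 'e \<Rightarrow> real" where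
  "Sbar M S = Re (expect M S S)"

definition Xbar :: "('e::ring_1, 'j::finite) thermal \<Rightarrow> 'e \<Rightarrow> real ^ 'j" where
  "Xbar M S = (\<chi> j. if j \<in> Idx M then Re (expect M S (Ext M j)) else 0)"

lemma (in thermal_system) expect_real:
  assumes "hermitian M S" "hermitian M g" "dens M S * g \<in> Intg M"
  shows "expect M S g \<in> \<real>"
proof -
  have "adj M (rscale M (- 1 / boltz M) S) = rscale M (- 1 / boltz M) S"
    using assms(1) by (simp add: rscale_def hermitian_def adj_mult adj_cst cst_central)
  then have ad: "adj M (dens M S) = dens M S"
    unfolding dens_def by (metis hermitian_def qexp_adj)
  have eq: "adj M (dens M S * g) = g * dens M S"
    using assms(2) ad by (simp add: adj_mult hermitian_def)
  have "cnj (expect M S g) = expect M S g"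
    unfolding expect_def
    using EA2_ext[OF assms(3)] Intg_adj[OF assms(3)] integ_adj_ext[OF assms(3)]
    by (simp add: eq)
  then show ?thesis by (simp add: Reals_cnj_iff)
qed

definition dotX :: "('e::ring_1, 'j::finite) thermal \<Rightarrow> real ^ 'j \<Rightarrow> 'e" where
  "dotX M \<alpha> = (\<Sum>j\<in>Idx M. rscale M (\<alpha> $ j) (Ext M j))"

definition dot :: "('e::ring_1, 'j::finite) thermal \<Rightarrow> real ^ 'j \<Rightarrow> real ^ 'j \<Rightarrow> real" where
  "dot M \<alpha> x = (\<Sum>j\<in>Idx M. \<alpha> $ j * x $ j)"

definition thermal_entropy ::
  "('e::ring_1, 'j::finite) thermal \<Rightarrow> real \<Rightarrow> real ^ 'j \<Rightarrow> 'e" where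
  "thermal_entropy M T \<alpha> = rscale M (1 / T) (Ham M - dotX M \<alpha>)"

text \<open>The Gibbs state with entropy \<open>S\<close> is thermal with temperature \<open>T\<close> and parameters \<open>\<alpha>\<close>.\<close>
definition thermal_state ::
  "('e::ring_1, 'j::finite) thermal \<Rightarrow> real \<Rightarrow> real ^ 'j \<Rightarrow> 'e \<Rightarrow> bool" where
  "thermal_state M T \<alpha> S \<longleftrightarrow> gibbs_state M S \<and> T \<noteq> 0 \<and> S = thermal_entropy M T \<alpha>"

definition Delta_dom :: "('e::ring_1, 'j::finite) thermal \<Rightarrow> (real \<times> (real ^ 'j)) set" where
  "Delta_dom M = {(T, \<alpha>). T \<noteq> 0 \<and> qexp M (rscale M (- 1 / (boltz M * T)) (Ham M - dotX M \<alpha>)) \<in> SI M}"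

text \<open>On \<open>Delta_dom\<close> the integral is a positive real number.\<close>
definition Delta :: "('e::ring_1, 'j::finite) thermal \<Rightarrow> real \<Rightarrow> real ^ 'j \<Rightarrow> real" where
  "Delta M T \<alpha> = kappa M * T *
     ln (Re (integ M (qexp M (rscale M (- 1 / (boltz M * T)) (Ham M - dotX M \<alpha>)))))"

subsection \<open>The potentials\<close>

text \<open>
  The potentials are partial functions: they are defined at those arguments where the set of
  feasible values has a greatest element.
\<close>

definition has_max :: "real set \<Rightarrow> bool" where
  "has_max V \<longleftrightarrow> (\<exists>u\<in>V. \<forall>v\<in>V. v \<le> u)"

definition maximum :: "real set \<Rightarrow> real" where
  "maximum V = (GREATEST u. u \<in> V)"

definition U_values :: "('e::ring_1, 'j::finite) thermal \<Rightarrow> real \<Rightarrow> real ^ 'j \<Rightarrow> real set" where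
  "U_values M s x = {T * s + dot M \<alpha> x | T \<alpha>. (T, \<alpha>) \<in> Delta_dom M \<and> Delta M T \<alpha> = 0 \<and> T > 0}"

definition U_defined :: "('e::ring_1, 'j::finite) thermal \<Rightarrow> real \<Rightarrow> real ^ 'j \<Rightarrow> bool" where
  "U_defined M s x \<longleftrightarrow> has_max (U_values M s x)"

definition U_pot :: "('e::ring_1, 'j::finite) thermal \<Rightarrow> real \<Rightarrow> real ^ 'j \<Rightarrow> real" where
  "U_pot M s x = maximum (U_values M s x)"

definition A_values :: "('e::ring_1, 'j::finite) thermal \<Rightarrow> real \<Rightarrow> real ^ 'j \<Rightarrow> real set" where
  "A_values M T x = {dot M \<alpha> x | \<alpha>. (T, \<alpha>) \<in> Delta_dom M \<and> Delta M T \<alpha> = 0}"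

definition A_defined :: "('e::ring_1, 'j::finite) thermal \<Rightarrow> real \<Rightarrow> real ^ 'j \<Rightarrow> bool" where
  "A_defined M T x \<longleftrightarrow> has_max (A_values M T x)"

definition A_pot :: "('e::ring_1, 'j::finite) thermal \<Rightarrow> real \<Rightarrow> real ^ 'j \<Rightarrow> real" where
  "A_pot M T x = maximum (A_values M T x)"

text \<open>The function \<open>f\<close>, defined where \<open>P\<close> holds, is defined around \<open>r\<close> and has derivative \<open>D\<close> there.\<close>
definition partial_deriv :: "(real \<Rightarrow> bool) \<Rightarrow> (real \<Rightarrow> real) \<Rightarrow> real \<Rightarrow> real \<Rightarrow> bool" where
  "partial_deriv P f r D \<longleftrightarrow> (\<forall>\<^sub>F y in nhds r. P y) \<and> (f has_real_derivative D) (at r)"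

definition vec_upd :: "real ^ 'j \<Rightarrow> 'j \<Rightarrow> real \<Rightarrow> real ^ 'j" where
  "vec_upd x j y = (\<chi> i. if i = j then y else x $ i)"

definition dU_dS :: "('e::ring_1, 'j::finite) thermal \<Rightarrow> real \<Rightarrow> real ^ 'j \<Rightarrow> real \<Rightarrow> bool" where
  "dU_dS M s x D \<longleftrightarrow> partial_deriv (\<lambda>s'. U_defined M s' x) (\<lambda>s'. U_pot M s' x) s D"

definition dU_dX ::
  "('e::ring_1, 'j::finite) thermal \<Rightarrow> 'j \<Rightarrow> real \<Rightarrow> real ^ 'j \<Rightarrow> real \<Rightarrow> bool" where
  "dU_dX M j s x D \<longleftrightarrow>
     partial_deriv (\<lambda>y. U_defined M s (vec_upd x j y)) (\<lambda>y. U_pot M s (vec_upd x j y)) (x $ j) D"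

definition dA_dT :: "('e::ring_1, 'j::finite) thermal \<Rightarrow> real \<Rightarrow> real ^ 'j \<Rightarrow> real \<Rightarrow> bool" where
  "dA_dT M T x D \<longleftrightarrow> partial_deriv (\<lambda>T'. A_defined M T' x) (\<lambda>T'. A_pot M T' x) T D"

definition dA_dX ::
  "('e::ring_1, 'j::finite) thermal \<Rightarrow> 'j \<Rightarrow> real \<Rightarrow> real ^ 'j \<Rightarrow> real \<Rightarrow> bool" where
  "dA_dX M j T x D \<longleftrightarrow>
     partial_deriv (\<lambda>y. A_defined M T (vec_upd x j y)) (\<lambda>y. A_pot M T (vec_upd x j y)) (x $ j) D"

subsection \<open>Regular parameters\<close>

definition C2_on :: "'a::real_normed_vector set \<Rightarrow> ('a \<Rightarrow> real) \<Rightarrow> bool" where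
  "C2_on N f \<longleftrightarrow>
     (\<exists>(f' :: 'a \<Rightarrow> 'a \<Rightarrow>\<^sub>L real) (f'' :: 'a \<Rightarrow> 'a \<Rightarrow>\<^sub>L ('a \<Rightarrow>\<^sub>L real)).
        (\<forall>p\<in>N. (f has_derivative blinfun_apply (f' p)) (at p) \<and>
               (f' has_derivative blinfun_apply (f'' p)) (at p)) \<and>
        continuous_on N f'')"

definition regular_at :: "('e::ring_1, 'j::finite) thermal \<Rightarrow> real \<Rightarrow> real ^ 'j \<Rightarrow> bool" where
  "regular_at M T \<alpha> \<longleftrightarrow>
     (\<exists>N. open N \<and> (T, \<alpha>) \<in> N \<and> N \<subseteq> Delta_dom M \<and> C2_on N (\<lambda>(T, \<alpha>). Delta M T \<alpha>))"

text \<open>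
  \<open>H\<close> and the \<open>X\<^sub>j\<close> are linearly independent over the reals.  If they are not, an entropy
  \<open>T\<^sup>-\<^sup>1(H - \<alpha>\<cdot>X)\<close> need not determine \<open>T\<close> and \<open>\<alpha>\<close>, and \<open>U\<close> need not be defined in a neighbourhood of
  \<open>(S, X)\<close>: for \<open>X\<^sub>1 = X\<^sub>2\<close>, it is defined only at arguments with equal components \<open>x\<^sub>1 = x\<^sub>2\<close>.

  Even for independent variables, \<open>\<partial>A/\<partial>T\<close> need not exist at a thermal state with \<open>Xbar = 0\<close>:
  there \<open>\<alpha>\<close> minimizes the convex function \<open>Delta M T\<close>, so that \<open>Delta M T' \<alpha>' = 0\<close> has no solution
  \<open>\<alpha>'\<close> for \<open>T'\<close> on one side of \<open>T\<close> if \<open>Sbar \<noteq> 0\<close>.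
\<close>
definition independent_variables :: "('e::ring_1, 'j::finite) thermal \<Rightarrow> bool" where
  "independent_variables M \<longleftrightarrow>
     (\<forall>(a::real) b. rscale M a (Ham M) + dotX M b = 0 \<longrightarrow> a = 0 \<and> (\<forall>j\<in>Idx M. b $ j = 0))"

end

(*
  Gibbs' inequality \<integral> e^f (g - f) \<le> \<integral> e^g - \<integral> e^f, strict for f \<noteq> g, is applied to f = -S/k and
  g = -(H - \<alpha>\<cdot>X)/(kT).  On {\<Delta> = 0} both integrals of exponentials are 1, so it says
  T Sbar + \<alpha>\<cdot>Xbar \<le> Hbar with equality iff S = T^(-1)(H - \<alpha>\<cdot>X); this gives all inequalities, equality
  cases and uniqueness statements.  The same bound touches the potentials from one side at a thermal
  state and so fixes the value of any derivative.

  Differentiability needs no implicit function theorem.  By Gibbs' inequality the set {\<Delta> \<le> 0} is convex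
  and (T, \<alpha>) is the only maximizer of the functional (Sbar, Xbar) on it, so by compactness the
  functionals near (Sbar, Xbar) attain their maximum near (T, \<alpha>), and their maximum differs from
  their value at (T, \<alpha>) only by a little-o of the distance.  For the derivative of A in T the constraint set varies
  with T; there Gibbs' inequality bounds A from above, and a feasible point on the line
  \<alpha> + \<real> Xbar bounds it from below.
*)
theory Submission
  imports Defs
begin

section \<open>The integral and Gibbs' inequality\<close>

text \<open>Since f and g need not commute, Gibbs' inequality cannot be read off from the scalar
  bound \<open>1 + x \<le> e^x\<close>; it comes from convexity along the path
  \<open>e^((1-t)f) e^(tg)\<close>, where cyclicity of the integral turns midpoint defects into
  squared norms. The potentials maximize over a level set that is in general not convex. They are
  computed on the relaxation Z \<le> 1, Z being the integral of the exponential: where Z < 1 there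
  is room for a step in the direction of the functional, so a maximizer of a nonzero functional
  satisfies Z = 1 and is feasible. The obstacle is integrability. Convexity at an intermediate point
  uses the integrals of H and the X_j against the exponential at that point, and these are obtained
  only near regular parameters, from differentiability and the chain rule. Hence compactness and
  convexity are available only inside a ball, and a maximum found there is shown to be global by
  following a segment until it meets the sphere.\<close>

context euclidean_star_algebra
begin

lemma cst_0: "cst A 0 = 0"
  using cst_add[of 0 0] by simp

text \<open>The type of quantities is only a ring; this supplies real linear algebra
  (\<open>rs.\<close>) for the scalars embedded by \<open>cst\<close>.\<close>

sublocale rs: vector_space "rscale A"
proof
  fix a b :: real and x y :: 'e
  show "rscale A a (x + y) = rscale A a x + rscale A a y"
    by (simp add: rscale_def distrib_left)
  show "rscale A (a + b) x = rscale A a x + rscale A b x"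
    by (simp add: rscale_def cst_add distrib_right)
  show "rscale A a (rscale A b x) = rscale A (a * b) x"
    by (simp add: rscale_def cst_mult mult.assoc)
  show "rscale A 1 x = x"
    by (simp add: rscale_def cst_1)
qed

lemma rscale_mult_right: "g * rscale A r h = rscale A r (g * h)"
  by (metis cst_central mult.assoc rscale_def)

lemma adj_0: "adj A 0 = 0"
  using adj_add[of 0 0] by simp

lemma adj_minus: "adj A (- g) = - adj A g"
  using adj_add[of g "- g"] by (simp add: adj_0 eq_neg_iff_add_eq_0 add.commute)

lemma adj_diff: "adj A (g - h) = adj A g - adj A h"
  using adj_add[of g "- h"] by (simp add: adj_minus)

lemma hermitian_0: "hermitian A 0"
  by (simp add: hermitian_def adj_0)

lemma hermitian_add: "hermitian A g \<Longrightarrow> hermitian A h \<Longrightarrow> hermitian A (g + h)"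
  by (simp add: hermitian_def adj_add)

lemma hermitian_diff: "hermitian A g \<Longrightarrow> hermitian A h \<Longrightarrow> hermitian A (g - h)"
  by (simp add: hermitian_def adj_diff)

lemma hermitian_rscale: "hermitian A g \<Longrightarrow> hermitian A (rscale A r g)"
  by (simp add: hermitian_def rscale_def adj_mult adj_cst cst_central)

lemma hermitian_sum: "(\<And>i. i \<in> I \<Longrightarrow> hermitian A (f i)) \<Longrightarrow> hermitian A (sum f I)"
  by (induction I rule: infinite_finite_induct) (auto simp: hermitian_0 hermitian_add)

lemma Intg_0: "0 \<in> Intg A"
  using SI_0 SI_subset_Intg by blast

lemma Intg_rscale: "g \<in> Intg A \<Longrightarrow> rscale A r g \<in> Intg A"
  by (simp add: rscale_def Intg_scale)

lemma Intg_diff: "g \<in> Intg A \<Longrightarrow> h \<in> Intg A \<Longrightarrow> g - h \<in> Intg A"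
  using Intg_add[of g "rscale A (- 1) h"] Intg_rscale[of h "- 1"] by simp

lemma Intg_sum: "(\<And>i. i \<in> I \<Longrightarrow> f i \<in> Intg A) \<Longrightarrow> sum f I \<in> Intg A"
  by (induction I rule: infinite_finite_induct) (auto simp: Intg_0 Intg_add)

lemma integ_0: "integ A 0 = 0"
  using integ_add[OF Intg_0 Intg_0] by simp

lemma integ_rscale: "g \<in> Intg A \<Longrightarrow> integ A (rscale A r g) = complex_of_real r * integ A g"
  by (simp add: rscale_def integ_scale)

lemma integ_diff:
  assumes "g \<in> Intg A" "h \<in> Intg A"
  shows "integ A (g - h) = integ A g - integ A h"
  using integ_add[OF assms(1) Intg_rscale[OF assms(2), of "- 1"]] integ_rscale[OF assms(2), of "- 1"]
  by simp

lemma integ_sum: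
  "(\<And>i. i \<in> I \<Longrightarrow> f i \<in> Intg A) \<Longrightarrow> integ A (sum f I) = (\<Sum>i\<in>I. integ A (f i))"
  by (induction I rule: infinite_finite_induct) (auto simp: integ_0 integ_add Intg_sum)

text \<open>Polarization; with values of the interpolating family for \<open>a\<close> and
  \<open>b\<close> it expresses midpoint defects as squared norms.\<close>

lemma square_integrable_diff_integ:
  assumes "square_integrable A a" "square_integrable A b"
  shows "square_integrable A (a - b)"
    and "integ A (adj A (a - b) * (a - b)) =
      integ A (adj A a * a) + integ A (adj A b * b) - integ A (adj A a * b) - integ A (adj A b * a)"
proof -
  have eq: "adj A (a - b) * (a - b) = (adj A a * a + adj A b * b) - adj A a * b - adj A b * a"
    by (simp add: adj_diff algebra_simps)
  have I: "adj A a * a \<in> Intg A" "adj A b * b \<in> Intg A" "adj A a * b \<in> Intg A" "adj A b * a \<in> Intg A"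
    using assms Intg_mult by (auto simp: square_integrable_def)
  show "square_integrable A (a - b)"
    unfolding square_integrable_def eq using I by (intro Intg_diff Intg_add)
  show "integ A (adj A (a - b) * (a - b)) =
      integ A (adj A a * a) + integ A (adj A b * b) - integ A (adj A a * b) - integ A (adj A b * a)"
    unfolding eq using I by (simp add: integ_diff integ_add Intg_diff Intg_add)
qed

end

context quantity_calculus
begin

lemma qexp_0: "qexp A 0 = 1"
  using qexp_cst[of 0] by (simp add: cst_0 cst_1)

lemma qexp_half: "hermitian A f \<Longrightarrow> qexp A (rscale A (1/2) f) * qexp A (rscale A (1/2) f) = qexp A f"
  using qexp_add[of f "1/2" "1/2"] by simp

lemma adj_qexp: "hermitian A f \<Longrightarrow> adj A (qexp A f) = qexp A f"
  using qexp_adj[of f] by (simp add: hermitian_def)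

text \<open>The exponential is the square of the Hermitian quantity \<open>e^(f/2)\<close>, which is
  nonzero because \<open>e^(-f/2)\<close> inverts it; so \<open>EA3_ext\<close> applies.\<close>

lemma integ_qexp_pos:
  assumes f: "hermitian A f" and SI: "qexp A f \<in> SI A"
  shows "integ A (qexp A f) \<in> \<real>" "Re (integ A (qexp A f)) > 0"
proof -
  let ?h = "qexp A (rscale A (1/2) f)"
  have h: "adj A ?h * ?h = qexp A f"
    using f by (simp add: adj_qexp hermitian_rscale qexp_half)
  have "?h * qexp A (rscale A (- 1/2) f) = 1"
    using qexp_add[OF f, of "1/2" "- 1/2"] by (simp add: qexp_0)
  then have "?h \<noteq> 0" by auto
  moreover have "square_integrable A ?h"
    using SI SI_subset_Intg by (auto simp: square_integrable_def h)
  ultimately show "integ A (qexp A f) \<in> \<real>" "Re (integ A (qexp A f)) > 0"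
    using EA3_ext[of ?h] by (auto simp: h)
qed

text \<open>
  The function \<open>\<phi>(u) = \<integral>e\<^bsup>(1-u)f\<^esup> e\<^bsup>ug\<^esup>\<close> is midpoint convex, so its difference quotients at \<open>0\<close>
  decrease along \<open>u = 2\<^bsup>-n\<^esup>\<close> to \<open>\<phi>'(0) = \<integral>e\<^bsup>f\<^esup>(g - f)\<close>.
\<close>
theorem gibbs_bogoliubov:
  assumes f: "hermitian A f" and g: "hermitian A g"
    and SI: "qexp A f \<in> SI A" "qexp A g \<in> SI A"
    and I: "qexp A f * (g - f) \<in> Intg A"
  shows "Re (integ A (qexp A f * (g - f))) \<le> Re (integ A (qexp A g)) - Re (integ A (qexp A f))"
    and "Re (integ A (qexp A f * (g - f))) = Re (integ A (qexp A g)) - Re (integ A (qexp A f)) \<Longrightarrow> f = g"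
proof -
  define E where "E u = qexp A (rscale A (1 - u) f) * qexp A (rscale A u g)" for u
  define w where "w u = qexp A (rscale A ((1 - u)/2) f) * qexp A (rscale A (u/2) g)" for u
  define \<phi> where "\<phi> u = Re (integ A (E u))" for u
  have E: "E u \<in> Intg A" and w: "square_integrable A (w u)" if "0 \<le> u" "u \<le> 1" for u
    using interpolation[OF f g SI that] by (auto simp: E_def w_def)
  \<comment> \<open>The exponents in \<open>w\<close> are half of those in \<open>E\<close>. In the
    product the two f-factors meet in the middle, and moving the left g-factor to the right end
    under the integral leaves \<open>E\<close> at the midpoint.\<close>
  have cyc: "integ A (adj A (w s) * w t) = integ A (E ((s + t)/2))"
    if st: "0 \<le> s" "s \<le> 1" "0 \<le> t" "t \<le> 1" for s t
  proof -
    let ?a = "qexp A (rscale A (s/2) g)" and ?m = "qexp A (rscale A (1 - (s + t)/2) f)"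
      and ?b = "qexp A (rscale A (t/2) g)"
    have m: "qexp A (rscale A ((1 - s)/2) f) * qexp A (rscale A ((1 - t)/2) f) = ?m"
    proof -
      have "(1 - s)/2 + (1 - t)/2 = 1 - (s + t)/2" by (simp add: field_simps)
      then show ?thesis by (simp only: qexp_add[OF f])
    qed
    have 1: "adj A (w s) * w t = ?a * (?m * ?b)"
      unfolding w_def m[symmetric]
      using f g by (simp add: adj_mult adj_qexp hermitian_rscale mult.assoc)
    have "(?m * ?b) * ?a = ?m * qexp A (rscale A ((s + t)/2) g)"
      using qexp_add[OF g, of "t/2" "s/2"] by (simp add: mult.assoc add_divide_distrib add.commute)
    then have 2: "(?m * ?b) * ?a = E ((s + t)/2)"
      by (simp add: E_def)
    have "adj A (w s) * w t \<in> Intg A"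
      using Intg_mult w st by blast
    moreover have "E ((s + t)/2) \<in> Intg A"
      using st by (intro E) auto
    ultimately show ?thesis
      using EA2_ext[of ?a "?m * ?b"] by (simp add: 1 2)
  qed
  \<comment> \<open>The midpoint defect of \<phi> is thus the squared norm of
    \<open>w s - w t\<close>: positivity gives convexity, and strict positivity detects
    equality.\<close>
  have gap: "Re (integ A (adj A (w s - w t) * (w s - w t))) = \<phi> s + \<phi> t - 2 * \<phi> ((s + t)/2)"
    if "0 \<le> s" "s \<le> 1" "0 \<le> t" "t \<le> 1" for s t
    using square_integrable_diff_integ(2)[OF w w, of s t] that
    by (simp add: cyc \<phi>_def add.commute)
  have mid: "2 * \<phi> ((s + t)/2) \<le> \<phi> s + \<phi> t"
    and mid_eq: "2 * \<phi> ((s + t)/2) = \<phi> s + \<phi> t \<Longrightarrow> w s = w t"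
    if st: "0 \<le> s" "s \<le> 1" "0 \<le> t" "t \<le> 1" for s t
  proof -
    have "w s = w t \<or> \<phi> s + \<phi> t - 2 * \<phi> ((s + t)/2) > 0"
      using EA3_ext[OF square_integrable_diff_integ(1)[OF w w], of s t] st gap[OF st] by force
    moreover have "w s = w t \<Longrightarrow> \<phi> s + \<phi> t - 2 * \<phi> ((s + t)/2) = 0"
      using gap[OF st] by (simp add: integ_0)
    ultimately show "2 * \<phi> ((s + t)/2) \<le> \<phi> s + \<phi> t"
      "2 * \<phi> ((s + t)/2) = \<phi> s + \<phi> t \<Longrightarrow> w s = w t" by auto
  qed
  define d where "d = Re (integ A (qexp A f * (g - f)))"
  have "((\<lambda>u. integ A (E u)) has_vector_derivative integ A (qexp A f * (g - f))) (at 0 within {0..1})"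
    using integ_interchange[OF f g SI, of 0] I by (simp add: qexp_0 E_def)
  then have "(\<phi> has_vector_derivative d) (at 0 within {0..1})"
    unfolding \<phi>_def d_def
    by (rule bounded_linear.has_vector_derivative[OF bounded_linear_Re])
  then have der: "((\<lambda>x. (\<phi> x - \<phi> 0) / (x - 0)) \<longlongrightarrow> d) (at 0 within {0..1})"
    by (simp add: has_real_derivative_iff_has_vector_derivative[symmetric] has_field_derivative_iff)
  define q where "q n = (\<phi> ((1/2)^n) - \<phi> 0) / (1/2)^n" for n :: nat
  have pw: "(\<lambda>n. (1/2::real)^n) \<longlonglongrightarrow> 0"
    by (rule LIMSEQ_realpow_zero) auto
  have "filterlim (\<lambda>n. (1/2::real)^n) (at 0 within {0..1}) sequentially"
    unfolding filterlim_at using pw by (auto simp: power_le_one)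
  from filterlim_compose[OF der this] have lim: "q \<longlonglongrightarrow> d"
    by (simp add: q_def[abs_def])
  have step: "q (Suc n) \<le> q n" for n
  proof -
    define a :: real where "a = (1/2)^n"
    have "0 < a" "a \<le> 1" by (auto simp: a_def power_le_one)
    then have "2 * (\<phi> (a/2) - \<phi> 0) \<le> \<phi> a - \<phi> 0"
      using mid[of 0 a] by simp
    then have "2 * (\<phi> (a/2) - \<phi> 0) / a \<le> (\<phi> a - \<phi> 0) / a"
      using \<open>0 < a\<close> by (intro divide_right_mono) auto
    then have "(\<phi> (a/2) - \<phi> 0) / (a/2) \<le> (\<phi> a - \<phi> 0) / a"
      by (simp add: mult.commute)
    then show ?thesis by (simp add: q_def a_def)
  qed
  then have "decseq q" by (rule decseq_SucI)
  then have dle: "d \<le> q n" for n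
    using decseq_ge lim by blast
  have \<phi>0: "\<phi> 0 = Re (integ A (qexp A f))" and \<phi>1: "\<phi> 1 = Re (integ A (qexp A g))"
    by (simp_all add: \<phi>_def E_def qexp_0)
  show "Re (integ A (qexp A f * (g - f))) \<le> Re (integ A (qexp A g)) - Re (integ A (qexp A f))"
    using dle[of 0] by (simp add: q_def \<phi>0 \<phi>1 d_def)
  assume "Re (integ A (qexp A f * (g - f))) = Re (integ A (qexp A g)) - Re (integ A (qexp A f))"
  \<comment> \<open>The decreasing \<open>q\<close> is squeezed between \<open>d\<close> and
    \<open>q 0\<close>, so its first step is an equality. That step is the midpoint inequality for 0
    and 1, whence \<open>w 0 = w 1\<close>, that is \<open>e^(f/2) = e^(g/2)\<close>; the logarithm
    then gives f = g.\<close>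
  then have "d = q 0" by (simp add: q_def \<phi>0 \<phi>1 d_def)
  then have "q 1 = q 0" using dle[of 1] step[of 0] by simp
  then have "2 * \<phi> ((0 + 1)/2) = \<phi> 0 + \<phi> 1" by (simp add: q_def field_simps)
  then have "w 0 = w 1" by (intro mid_eq) auto
  then have "qexp A (rscale A (1/2) f) = qexp A (rscale A (1/2) g)"
    by (simp add: w_def qexp_0)
  then have "qlog A (qexp A (rscale A (1/2) f)) = qlog A (qexp A (rscale A (1/2) g))"
    by (rule arg_cong)
  then have "rscale A (1/2) f = rscale A (1/2) g"
    unfolding qlog_qexp[OF hermitian_rscale[OF f]] qlog_qexp[OF hermitian_rscale[OF g]] .
  then show "f = g" by simp
qed

end

section \<open>Maxima of linear functionals\<close>

text \<open>A maximum over the ball is a maximum over all of \<open>C\<close>: a segment from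
  \<open>p\<close> to a point of \<open>C\<close> outside the ball crosses the sphere, where the
  functional is already below its value at \<open>p\<close>, and along the segment it is affine.
  Only the part of the segment inside the ball has to lie in \<open>C\<close>.\<close>

lemma inner_max_on_sublevel:
  fixes C :: "'a::euclidean_space set" and c p y :: 'a
  assumes p: "p \<in> C" "dist c p < r" and K: "compact (C \<inter> cball c r)"
    and seg: "\<And>p' q. p' \<in> C \<Longrightarrow> q \<in> closed_segment p p' \<Longrightarrow> q \<in> cball c r \<Longrightarrow> q \<in> C"
    and sph: "\<And>q. q \<in> C \<Longrightarrow> dist c q = r \<Longrightarrow> q \<bullet> y < p \<bullet> y"
  obtains m where "m \<in> C" "dist c m < r" "\<And>p'. p' \<in> C \<Longrightarrow> p' \<bullet> y \<le> m \<bullet> y"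
proof -
  have "p \<in> C \<inter> cball c r" using p by simp
  then obtain m where m: "m \<in> C \<inter> cball c r" "\<And>q. q \<in> C \<inter> cball c r \<Longrightarrow> q \<bullet> y \<le> m \<bullet> y"
    using continuous_attains_sup[OF K, of "\<lambda>q. q \<bullet> y"] by (force intro: continuous_intros)
  have pm: "p \<bullet> y \<le> m \<bullet> y" using m p by simp
  show ?thesis
  proof
    show "m \<in> C" using m by simp
    show "dist c m < r" using m sph[of m] pm by (cases "dist c m = r") auto
    fix p' assume p': "p' \<in> C"
    show "p' \<bullet> y \<le> m \<bullet> y"
    proof (cases "dist c p' \<le> r")
      case True
      then show ?thesis using m p' by simp
    next
      case False
      define \<gamma> where "\<gamma> u = (1 - u) *\<^sub>R p + u *\<^sub>R p'" for u
      have "\<exists>u\<ge>0. u \<le> 1 \<and> dist c (\<gamma> u) = r"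
        using p False by (intro IVT') (auto simp: \<gamma>_def intro!: continuous_intros)
      then obtain u where u: "0 \<le> u" "u \<le> 1" "dist c (\<gamma> u) = r" by auto
      have "\<gamma> u \<in> closed_segment p p'"
        using u by (auto simp: \<gamma>_def in_segment)
      then have "\<gamma> u \<in> C" using seg[OF p'] u by auto
      then have "\<gamma> u \<bullet> y < p \<bullet> y" using sph u by simp
      then have "u * (p' \<bullet> y - p \<bullet> y) < 0"
        by (simp add: \<gamma>_def inner_add_left algebra_simps)
      then have "p' \<bullet> y < p \<bullet> y"
        using u by (simp add: mult_less_0_iff)
      then show ?thesis using pm by simp
    qed
  qed
qed

text \<open>Compactness makes the strict inequality uniform. The empty set has to be covered, since
  the sphere may miss \<open>C\<close>.\<close>

lemma strict_max_gap:
  fixes K :: "'a::euclidean_space set"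
  assumes "compact K" "\<And>q. q \<in> K \<Longrightarrow> (q - p) \<bullet> y < 0"
  obtains c :: real where "c > 0" "\<And>q. q \<in> K \<Longrightarrow> (q - p) \<bullet> y \<le> - c"
proof (cases "K = {}")
  case True
  then show ?thesis using that[of 1] by simp
next
  case False
  then obtain m where m: "m \<in> K" "\<And>q. q \<in> K \<Longrightarrow> (q - p) \<bullet> y \<le> (m - p) \<bullet> y"
    using continuous_attains_sup[OF assms(1), of "\<lambda>q. (q - p) \<bullet> y"] by (force intro: continuous_intros)
  show ?thesis using that[of "- ((m - p) \<bullet> y)"] m assms(2) by simp
qed

text \<open>
  The maximum of a linear functional is differentiable at \<open>y0\<close>, with derivative \<open>p0\<close>, if \<open>p0\<close> is
  the only maximizer there: maximizers for nearby \<open>y\<close> cannot leave a small ball around \<open>p0\<close>.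
\<close>
lemma support_function_derivative:
  fixes C F Y :: "'a::euclidean_space set"
  assumes p0: "p0 \<in> C" and R: "0 < R" and K: "compact (C \<inter> cball p0 R)"
    and seg: "\<And>p q. p \<in> C \<Longrightarrow> q \<in> closed_segment p0 p \<Longrightarrow> q \<in> cball p0 R \<Longrightarrow> q \<in> C"
    and strict: "\<And>p. p \<in> C \<Longrightarrow> p \<noteq> p0 \<Longrightarrow> (p - p0) \<bullet> y0 < 0"
    and F: "p0 \<in> F"
    and room: "\<And>p y. p \<in> C \<Longrightarrow> p \<notin> F \<Longrightarrow> dist p0 p < R \<Longrightarrow> y \<in> Y \<Longrightarrow> \<exists>t>0. p + t *\<^sub>R y \<in> C"
    and \<epsilon>: "\<epsilon> > 0"
  obtains \<delta> where "\<delta> > 0" "\<And>y. y \<in> Y \<Longrightarrow> dist y y0 < \<delta> \<Longrightarrow>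
    \<exists>m\<in>C \<inter> F. (\<forall>p\<in>C. p \<bullet> y \<le> m \<bullet> y) \<and> m \<bullet> y \<le> p0 \<bullet> y + \<epsilon> * dist y y0"
proof -
  \<comment> \<open>A maximizer within r \<le> \<epsilon> of \<open>p0\<close> turns the
    Cauchy-Schwarz term below into \<open>\<epsilon> * dist y y0\<close>.\<close>
  define r where "r = min R \<epsilon>"
  have r: "0 < r" "r \<le> R" "r \<le> \<epsilon>" using R \<epsilon> by (auto simp: r_def)
  have Kr: "compact (C \<inter> cball p0 r)"
  proof -
    have "C \<inter> cball p0 r = (C \<inter> cball p0 R) \<inter> cball p0 r" using r by auto
    then show ?thesis using K by (metis compact_Int_closed closed_cball)
  qed
  have "C \<inter> sphere p0 r = (C \<inter> cball p0 r) \<inter> sphere p0 r" by auto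
  then have "compact (C \<inter> sphere p0 r)" using Kr by (metis compact_Int_closed closed_sphere)
  moreover have "(q - p0) \<bullet> y0 < 0" if "q \<in> C \<inter> sphere p0 r" for q
    using strict[of q] that r by auto
  ultimately obtain c where c: "c > 0" "\<And>q. q \<in> C \<inter> sphere p0 r \<Longrightarrow> (q - p0) \<bullet> y0 \<le> - c"
    using strict_max_gap by blast
  \<comment> \<open>On the sphere, replacing \<open>y0\<close> by \<open>y\<close> changes the
    functional by at most \<open>r * dist y y0\<close>, which \<open>c / r\<close> keeps below the
    gap \<open>c\<close>. The other bound ensures \<open>y \<noteq> 0\<close> whenever
    \<open>y0 \<noteq> 0\<close>.\<close>
  define \<delta> where "\<delta> = min (c / r) (if y0 = 0 then 1 else norm y0)"
  have "\<delta> > 0" using c r by (simp add: \<delta>_def)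
  moreover have "\<exists>m\<in>C \<inter> F. (\<forall>p\<in>C. p \<bullet> y \<le> m \<bullet> y) \<and> m \<bullet> y \<le> p0 \<bullet> y + \<epsilon> * dist y y0"
    if y: "y \<in> Y" "dist y y0 < \<delta>" for y
  proof -
    have cs: "(q - p0) \<bullet> (y - y0) \<le> dist p0 q * dist y y0" for q
      using norm_cauchy_schwarz[of "q - p0" "y - y0"] by (simp add: dist_norm norm_minus_commute)
    have sph: "q \<bullet> y < p0 \<bullet> y" if q: "q \<in> C" "dist p0 q = r" for q
    proof -
      have "r * dist y y0 < c" using y r by (simp add: \<delta>_def field_simps)
      then have "(q - p0) \<bullet> y0 + (q - p0) \<bullet> (y - y0) < 0"
        using c(2)[of q] cs[of q] q by simp
      then show ?thesis by (simp add: algebra_simps)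
    qed
    obtain m where m: "m \<in> C" "dist p0 m < r" "\<And>p. p \<in> C \<Longrightarrow> p \<bullet> y \<le> m \<bullet> y"
    proof (rule inner_max_on_sublevel[of p0 C p0 r y])
      show "q \<in> C" if "p \<in> C" "q \<in> closed_segment p0 p" "q \<in> cball p0 r" for p q
        using seg[OF that(1,2)] that(3) r by auto
    qed (use p0 r Kr sph in auto)
    \<comment> \<open>A maximizer off \<open>F\<close> could be moved along \<open>y\<close>,
      raising the functional by t times the squared norm of \<open>y\<close>. If
      \<open>y0 = 0\<close>, then \<open>strict\<close> leaves only \<open>p0\<close> in
      \<open>C\<close>.\<close>
    have "m \<in> F"
    proof (cases "y0 = 0")
      case True
      then show ?thesis using strict[OF m(1)] F by auto
    next
      case False
      then have "y \<noteq> 0" using y by (auto simp: \<delta>_def)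
      show ?thesis
      proof (rule ccontr)
        assume "m \<notin> F"
        then obtain t where "t > 0" "m + t *\<^sub>R y \<in> C"
          using room[of m y] m y r by auto
        then have "t * (y \<bullet> y) \<le> 0" using m(3) by (force simp: inner_add_left)
        moreover have "0 < t * (y \<bullet> y)"
          using \<open>t > 0\<close> \<open>y \<noteq> 0\<close> by (intro mult_pos_pos) auto
        ultimately show False by linarith
      qed
    qed
    moreover have "m \<bullet> y \<le> p0 \<bullet> y + \<epsilon> * dist y y0"
    proof -
      have "(m - p0) \<bullet> y0 \<le> 0" using strict[OF m(1)] by (cases "m = p0") auto
      moreover have "dist p0 m * dist y y0 \<le> \<epsilon> * dist y y0"
        using m r by (intro mult_right_mono) auto
      ultimately have "(m - p0) \<bullet> y0 + (m - p0) \<bullet> (y - y0) \<le> \<epsilon> * dist y y0"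
        using cs[of m] by simp
      then show ?thesis by (simp add: algebra_simps)
    qed
    ultimately show ?thesis using m by blast
  qed
  ultimately show ?thesis using that by blast
qed

section \<open>Derivatives and maxima of partially defined real functions\<close>

lemma partial_derivI:
  assumes "\<And>\<epsilon>. \<epsilon> > 0 \<Longrightarrow>
    \<exists>\<delta>>0. \<forall>s. \<bar>s - r\<bar> < \<delta> \<longrightarrow> P s \<and> \<bar>f s - f r - D * (s - r)\<bar> \<le> \<epsilon> * \<bar>s - r\<bar>"
  shows "partial_deriv P f r D"
  unfolding partial_deriv_def
proof
  obtain \<delta> where \<delta>: "\<delta> > 0" "\<forall>s. \<bar>s - r\<bar> < \<delta> \<longrightarrow> P s"
    using assms[of 1] by auto
  then show "\<forall>\<^sub>F y in nhds r. P y"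
    unfolding eventually_nhds_metric by (auto simp: dist_real_def)
  show "(f has_real_derivative D) (at r)"
    unfolding has_field_derivative_def has_derivative_at_alt
  proof (intro conjI allI impI)
    show "bounded_linear ((*) D)" by (rule bounded_linear_mult_right)
    fix \<epsilon> :: real assume "\<epsilon> > 0"
    from assms[OF this] show "\<exists>d>0. \<forall>s. norm (s - r) < d \<longrightarrow>
        norm (f s - f r - D * (s - r)) \<le> \<epsilon> * norm (s - r)"
      unfolding real_norm_def by blast
  qed
qed

text \<open>Subtracting the supporting line leaves a local minimum at \<open>r\<close>;
  \<open>partial_deriv\<close> itself guarantees that \<open>P\<close> holds nearby.\<close>

lemma partial_deriv_support:
  assumes D: "partial_deriv P f r D" and e: "e > 0"
    and le: "\<And>s. \<bar>s - r\<bar> < e \<Longrightarrow> P s \<Longrightarrow> f r + c * (s - r) \<le> f s"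
  shows "D = c"
proof -
  obtain d where d: "d > 0" "\<And>s. \<bar>s - r\<bar> < d \<Longrightarrow> P s"
    using D unfolding partial_deriv_def eventually_nhds_metric by (auto simp: dist_real_def)
  have "((\<lambda>s. f s - c * (s - r)) has_real_derivative D - c) (at r)"
    using D unfolding partial_deriv_def by (auto intro!: derivative_eq_intros)
  then have "D - c = 0"
  proof (rule DERIV_local_min)
    show "0 < min d e" using d e by simp
    show "\<forall>y. \<bar>r - y\<bar> < min d e \<longrightarrow> f r - c * (r - r) \<le> f y - c * (y - r)"
    proof (intro allI impI)
      fix y assume "\<bar>r - y\<bar> < min d e"
      then have "\<bar>y - r\<bar> < d" "\<bar>y - r\<bar> < e" by (auto simp: abs_minus_commute)
      then show "f r - c * (r - r) \<le> f y - c * (y - r)"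
        using le[of y] d(2)[of y] by simp
    qed
  qed
  then show ?thesis by simp
qed

lemma partial_deriv_minus: "partial_deriv P f r D \<Longrightarrow> partial_deriv P (\<lambda>s. - f s) r (- D)"
  by (auto simp: partial_deriv_def intro!: derivative_intros)

lemma maximumI:
  assumes "v \<in> V" "\<And>w. w \<in> V \<Longrightarrow> w \<le> v"
  shows "has_max V" "maximum V = v"
  using assms by (auto simp: has_max_def maximum_def intro!: Greatest_equality)

lemma maximumD:
  assumes "has_max V"
  shows "maximum V \<in> V" "w \<in> V \<Longrightarrow> w \<le> maximum V"
  using assms maximumI unfolding has_max_def by metis+

section \<open>Thermal systems\<close>

definition gibbs_exponent :: "('e::ring_1, 'j::finite) thermal \<Rightarrow> real \<Rightarrow> real ^ 'j \<Rightarrow> 'e" where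
  "gibbs_exponent M T \<alpha> = rscale M (- 1 / (boltz M * T)) (Ham M - dotX M \<alpha>)"

definition partition_function :: "('e::ring_1, 'j::finite) thermal \<Rightarrow> real \<Rightarrow> real ^ 'j \<Rightarrow> real" where
  "partition_function M T \<alpha> = Re (integ M (qexp M (gibbs_exponent M T \<alpha>)))"

text \<open>The part of \<open>has_values\<close> that makes sense for any weight: it is also
  applied to exponentials that are not normalized.\<close>

definition integrable_against :: "('e::ring_1, 'j::finite) thermal \<Rightarrow> 'e \<Rightarrow> bool" where
  "integrable_against M e \<longleftrightarrow> e * Ham M \<in> Intg M \<and> (\<forall>j\<in>Idx M. e * Ext M j \<in> Intg M)"

lemma Delta_dom_iff:
  "(T, \<alpha>) \<in> Delta_dom M \<longleftrightarrow> T \<noteq> 0 \<and> qexp M (gibbs_exponent M T \<alpha>) \<in> SI M"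
  by (simp add: Delta_dom_def gibbs_exponent_def)

lemma Delta_eq: "Delta M T \<alpha> = kappa M * T * ln (partition_function M T \<alpha>)"
  by (simp add: Delta_def partition_function_def gibbs_exponent_def)

lemma dotX_cong: "(\<And>j. j \<in> Idx M \<Longrightarrow> \<alpha> $ j = \<beta> $ j) \<Longrightarrow> dotX M \<alpha> = dotX M \<beta>"
  by (simp add: dotX_def)

lemma dot_eq_inner:
  assumes "\<And>j. j \<notin> Idx M \<Longrightarrow> x $ j = 0"
  shows "dot M \<alpha> x = \<alpha> \<bullet> x"
  unfolding dot_def inner_vec_def using assms by (intro sum.mono_neutral_cong_left) auto

lemma Xbar_outside: "j \<notin> Idx M \<Longrightarrow> Xbar M S $ j = 0"
  by (simp add: Xbar_def)

context thermal_system
begin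

lemma boltz_nonzero: "boltz M \<noteq> 0"
  using boltz_pos by simp

lemma dotX_add: "dotX M (\<alpha> + \<beta>) = dotX M \<alpha> + dotX M \<beta>"
  by (simp add: dotX_def rs.scale_left_distrib sum.distrib)

lemma dotX_scaleR: "dotX M (r *\<^sub>R \<alpha>) = rscale M r (dotX M \<alpha>)"
  by (simp add: dotX_def rs.scale_sum_right)

lemma dotX_minus: "dotX M (- \<alpha>) = - dotX M \<alpha>"
  using dotX_scaleR[of "- 1" \<alpha>] by simp

lemma dotX_diff: "dotX M (\<alpha> - \<beta>) = dotX M \<alpha> - dotX M \<beta>"
  using dotX_add[of \<alpha> "- \<beta>"] by (simp add: dotX_minus)

lemma hermitian_dotX: "hermitian M (dotX M \<alpha>)"
  unfolding dotX_def by (intro hermitian_sum hermitian_rscale Ext_hermitian)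

lemma hermitian_gibbs_exponent: "hermitian M (gibbs_exponent M T \<alpha>)"
  unfolding gibbs_exponent_def
  by (intro hermitian_rscale hermitian_diff Ham_hermitian hermitian_dotX)

text \<open>In the coordinates \<open>1/(kT)\<close> and \<open>\<alpha>/(kT)\<close> the exponent
  is linear, so that its integrals reduce to \<open>integ_affine\<close>.\<close>

lemma gibbs_exponent_affine:
  "gibbs_exponent M T \<alpha> = rscale M (- 1 / (boltz M * T)) (Ham M) + dotX M ((1 / (boltz M * T)) *\<^sub>R \<alpha>)"
  by (simp add: gibbs_exponent_def dotX_scaleR rs.scale_right_diff_distrib)

lemma dens_thermal_entropy: "dens M (thermal_entropy M T \<alpha>) = qexp M (gibbs_exponent M T \<alpha>)"
  by (simp add: dens_def thermal_entropy_def gibbs_exponent_def)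

lemma rscale_thermal_entropy:
  "rscale M (- 1 / boltz M) (thermal_entropy M T \<alpha>) = gibbs_exponent M T \<alpha>"
  by (simp add: thermal_entropy_def gibbs_exponent_def)

lemma partition_function_pos:
  assumes "(T, \<alpha>) \<in> Delta_dom M"
  shows "0 < partition_function M T \<alpha>"
    and "integ M (qexp M (gibbs_exponent M T \<alpha>)) = complex_of_real (partition_function M T \<alpha>)"
  using integ_qexp_pos[OF hermitian_gibbs_exponent, of T \<alpha>] assms
  by (auto simp: Delta_dom_iff partition_function_def)

lemma Delta_eq_0_iff:
  assumes "(T, \<alpha>) \<in> Delta_dom M"
  shows "Delta M T \<alpha> = 0 \<longleftrightarrow> partition_function M T \<alpha> = 1"
  using partition_function_pos(1)[OF assms] assms kappa_pos
  by (simp add: Delta_eq Delta_dom_iff)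

lemma integ_affine:
  assumes "integrable_against M e"
  shows "e * (rscale M c (Ham M) + dotX M b) \<in> Intg M"
    and "Re (integ M (e * (rscale M c (Ham M) + dotX M b))) =
      c * Re (integ M (e * Ham M)) + (\<Sum>j\<in>Idx M. b $ j * Re (integ M (e * Ext M j)))"
proof -
  have eq: "e * (rscale M c (Ham M) + dotX M b) =
      rscale M c (e * Ham M) + (\<Sum>j\<in>Idx M. rscale M (b $ j) (e * Ext M j))"
    by (simp add: distrib_left dotX_def sum_distrib_left rscale_mult_right)
  have I: "rscale M c (e * Ham M) \<in> Intg M"
    "\<And>j. j \<in> Idx M \<Longrightarrow> rscale M (b $ j) (e * Ext M j) \<in> Intg M"
    using assms by (auto simp: integrable_against_def intro: Intg_rscale)
  show "e * (rscale M c (Ham M) + dotX M b) \<in> Intg M"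
    unfolding eq by (intro Intg_add Intg_sum I)
  show "Re (integ M (e * (rscale M c (Ham M) + dotX M b))) =
      c * Re (integ M (e * Ham M)) + (\<Sum>j\<in>Idx M. b $ j * Re (integ M (e * Ext M j)))"
    unfolding eq using assms I
    by (simp add: integ_add Intg_sum integ_sum integ_rscale integrable_against_def)
qed

text \<open>Stated for either sign of T and without normalizing the partition function: in this form
  it also determines the derivative of the partition function at a thermal state.\<close>

lemma gibbs_inequality:
  assumes S: "gibbs_state M S" "has_values M S" and dom: "(T, \<alpha>) \<in> Delta_dom M"
  shows "(T * Sbar M S + dot M \<alpha> (Xbar M S) - Hbar M S) / (boltz M * T) \<le> partition_function M T \<alpha> - 1"
    and "(T * Sbar M S + dot M \<alpha> (Xbar M S) - Hbar M S) / (boltz M * T) = partition_function M T \<alpha> - 1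
      \<Longrightarrow> S = thermal_entropy M T \<alpha>"
proof -
  let ?f = "rscale M (- 1 / boltz M) S" and ?g = "gibbs_exponent M T \<alpha>" and ?b = "(1 / (boltz M * T)) *\<^sub>R \<alpha>"
  have T: "T \<noteq> 0" using dom by (simp add: Delta_dom_iff)
  have h: "hermitian M ?f" using S unfolding gibbs_state_def by (blast intro: hermitian_rscale)
  have SI: "qexp M ?f \<in> SI M" "qexp M ?g \<in> SI M" and d: "qexp M ?f = dens M S"
    using S dom by (auto simp: gibbs_state_def dens_def Delta_dom_iff)
  have e: "integrable_against M (dens M S)"
    using S by (auto simp: integrable_against_def has_values_def)
  have eq: "dens M S * (?g - ?f) = dens M S * ?g - rscale M (- 1 / boltz M) (dens M S * S)"
    by (simp add: right_diff_distrib distrib_left rscale_mult_right)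
  have DS: "dens M S * S \<in> Intg M" using S by (simp add: has_values_def)
  have I: "dens M S * ?g \<in> Intg M" "rscale M (- 1 / boltz M) (dens M S * S) \<in> Intg M"
    using integ_affine(1)[OF e] S
    unfolding gibbs_exponent_affine has_values_def by (blast intro: Intg_rscale)+
  have I': "qexp M ?f * (?g - ?f) \<in> Intg M"
    unfolding d eq by (intro Intg_diff I)
  have gval: "Re (integ M (dens M S * ?g)) = (dot M \<alpha> (Xbar M S) - Hbar M S) / (boltz M * T)"
    unfolding gibbs_exponent_affine integ_affine(2)[OF e]
    by (simp add: Hbar_def expect_def dot_def Xbar_def diff_divide_distrib sum_divide_distrib
        cong: sum.cong)
  have val: "Re (integ M (qexp M ?f * (?g - ?f))) =
      (T * Sbar M S + dot M \<alpha> (Xbar M S) - Hbar M S) / (boltz M * T)"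
    unfolding d eq integ_diff[OF I] integ_rscale[OF DS] minus_complex.sel gval using T boltz_pos
    by (simp add: Sbar_def expect_def field_simps)
  have one: "Re (integ M (qexp M ?f)) = 1" using S unfolding d by (simp add: gibbs_state_def)
  note gb = gibbs_bogoliubov[OF h hermitian_gibbs_exponent SI I',
      unfolded val one partition_function_def[symmetric]]
  show "(T * Sbar M S + dot M \<alpha> (Xbar M S) - Hbar M S) / (boltz M * T) \<le> partition_function M T \<alpha> - 1"
    by (rule gb(1))
  assume "(T * Sbar M S + dot M \<alpha> (Xbar M S) - Hbar M S) / (boltz M * T) = partition_function M T \<alpha> - 1"
  then have "?f = ?g" by (rule gb(2))
  then have "rscale M (- 1 / boltz M) S = rscale M (- 1 / boltz M) (thermal_entropy M T \<alpha>)"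
    by (simp only: rscale_thermal_entropy)
  then show "S = thermal_entropy M T \<alpha>"
    using boltz_pos by simp
qed

text \<open>The hypothesis allows partition functions below 1, so that it serves the convex
  relaxation as well as the feasible points. If equality holds, then 0 \<le> Z - 1 \<le> 0, which is
  the equality case of Gibbs' inequality.\<close>

lemma value_le:
  assumes S: "gibbs_state M S" "has_values M S"
    and dom: "(T, \<alpha>) \<in> Delta_dom M" "T > 0" "partition_function M T \<alpha> \<le> 1"
  shows "T * Sbar M S + dot M \<alpha> (Xbar M S) \<le> Hbar M S"
    and "T * Sbar M S + dot M \<alpha> (Xbar M S) = Hbar M S \<Longrightarrow> S = thermal_entropy M T \<alpha>"
proof -
  have "(T * Sbar M S + dot M \<alpha> (Xbar M S) - Hbar M S) / (boltz M * T) \<le> 0"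
    using gibbs_inequality(1)[OF S dom(1)] dom(3) by simp
  then show "T * Sbar M S + dot M \<alpha> (Xbar M S) \<le> Hbar M S"
    using mult_pos_pos[OF boltz_pos dom(2)] by (simp add: pos_divide_le_eq)
  assume "T * Sbar M S + dot M \<alpha> (Xbar M S) = Hbar M S"
  then show "S = thermal_entropy M T \<alpha>"
    using gibbs_inequality[OF S dom(1)] dom(3) by simp
qed

lemma thermal_stateD:
  assumes "thermal_state M T \<alpha> S"
  shows "gibbs_state M S" "T \<noteq> 0" "S = thermal_entropy M T \<alpha>" "(T, \<alpha>) \<in> Delta_dom M"
    "partition_function M T \<alpha> = 1" "Delta M T \<alpha> = 0"
proof -
  show 1: "gibbs_state M S" "T \<noteq> 0" "S = thermal_entropy M T \<alpha>"
    using assms by (auto simp: thermal_state_def)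
  show 2: "(T, \<alpha>) \<in> Delta_dom M"
    using 1 by (simp add: Delta_dom_iff gibbs_state_def dens_thermal_entropy)
  show "partition_function M T \<alpha> = 1"
    using 1 by (simp add: partition_function_def gibbs_state_def dens_thermal_entropy)
  then show "Delta M T \<alpha> = 0" using 2 by (simp add: Delta_eq_0_iff)
qed

text \<open>This is the expectation of the formula for the entropy of a thermal state; no inequality
  is involved.\<close>

lemma thermal_euler:
  assumes t: "thermal_state M T \<alpha> S" and v: "has_values M S"
  shows "T * Sbar M S + dot M \<alpha> (Xbar M S) = Hbar M S"
proof -
  have T: "T \<noteq> 0" and S: "S = thermal_entropy M T \<alpha>" using thermal_stateD[OF t] by auto
  have e: "integrable_against M (dens M S)"
    using v by (auto simp: integrable_against_def has_values_def)
  have "S = rscale M (1 / T) (Ham M) + dotX M ((- 1 / T) *\<^sub>R \<alpha>)"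
    by (subst S) (simp add: thermal_entropy_def dotX_scaleR rs.scale_right_diff_distrib dotX_minus)
  then have "Sbar M S = Re (integ M (dens M S * (rscale M (1 / T) (Ham M) + dotX M ((- 1 / T) *\<^sub>R \<alpha>))))"
    by (simp add: Sbar_def expect_def)
  also have "\<dots> = (Hbar M S - dot M \<alpha> (Xbar M S)) / T"
    unfolding integ_affine(2)[OF e]
    by (simp add: Hbar_def expect_def dot_def Xbar_def diff_divide_distrib sum_divide_distrib sum_negf
        cong: sum.cong)
  finally show ?thesis using T by (simp add: field_simps)
qed

text \<open>Write Z for the partition function at the intermediate point. Gibbs' inequality from
  there to an endpoint bounds \<open>L\<close> by 1 - Z. Multiplied by the endpoint's own
  temperature, \<open>L\<close> becomes affine in the endpoint and vanishes at the intermediate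
  point, so the weighted sum of the two bounds reads 0 \<le> T (1 - Z). It is at the intermediate
  point that the integrals of H and the X_j must exist.\<close>

lemma partition_function_convex:
  assumes q: "(T, \<alpha>) \<in> Delta_dom M" "integrable_against M (qexp M (gibbs_exponent M T \<alpha>))"
    and dom: "(T1, \<alpha>1) \<in> Delta_dom M" "(T2, \<alpha>2) \<in> Delta_dom M" and T: "T1 > 0" "T2 > 0"
    and Z: "partition_function M T1 \<alpha>1 \<le> 1" "partition_function M T2 \<alpha>2 \<le> 1"
    and u: "0 \<le> u" "u \<le> 1" "T = (1 - u) * T1 + u * T2" "\<alpha> = (1 - u) *\<^sub>R \<alpha>1 + u *\<^sub>R \<alpha>2"
  shows "partition_function M T \<alpha> \<le> 1"
proof -
  let ?f = "gibbs_exponent M T \<alpha>"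
  define L where "L T' \<alpha>' = Re (integ M (qexp M ?f * (gibbs_exponent M T' \<alpha>' - ?f)))" for T' \<alpha>'
  define h where "h = Re (integ M (qexp M ?f * Ham M))"
  define x where "x \<alpha>' = (\<Sum>j\<in>Idx M. \<alpha>' $ j * Re (integ M (qexp M ?f * Ext M j)))" for \<alpha>' :: "real ^ 'j"
  have Tpos: "T > 0"
    unfolding u(3) using u(1,2) T by (smt (verit) mult_nonneg_nonneg mult_pos_pos)
  have L: "qexp M ?f * (gibbs_exponent M T' \<alpha>' - ?f) \<in> Intg M"
      "T' * L T' \<alpha>' = ((T' / T) * (h - x \<alpha>) - (h - x \<alpha>')) / boltz M"
    if "T' > 0" for T' \<alpha>'
  proof -
    have eq: "gibbs_exponent M T' \<alpha>' - ?f = rscale M (1 / (boltz M * T) - 1 / (boltz M * T')) (Ham M) +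
        dotX M ((1 / (boltz M * T')) *\<^sub>R \<alpha>' - (1 / (boltz M * T)) *\<^sub>R \<alpha>)"
      by (simp add: gibbs_exponent_affine rs.scale_left_diff_distrib dotX_diff)
    show "qexp M ?f * (gibbs_exponent M T' \<alpha>' - ?f) \<in> Intg M"
      unfolding eq by (rule integ_affine(1)[OF q(2)])
    have val: "L T' \<alpha>' = (1 / (boltz M * T) - 1 / (boltz M * T')) * h + (x \<alpha>' / (boltz M * T') - x \<alpha> / (boltz M * T))"
      unfolding L_def eq integ_affine(2)[OF q(2)]
      by (simp add: h_def x_def left_diff_distrib sum_subtractf sum_divide_distrib)
    show "T' * L T' \<alpha>' = ((T' / T) * (h - x \<alpha>) - (h - x \<alpha>')) / boltz M"
      unfolding val using that Tpos boltz_pos by (simp add: field_simps)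
  qed
  have ineq: "L T' \<alpha>' \<le> 1 - partition_function M T \<alpha>"
    if "(T', \<alpha>') \<in> Delta_dom M" "T' > 0" "partition_function M T' \<alpha>' \<le> 1" for T' \<alpha>'
    using gibbs_bogoliubov(1)[OF hermitian_gibbs_exponent hermitian_gibbs_exponent _ _ L(1)[OF that(2)]]
      that q(1) by (fastforce simp: Delta_dom_iff partition_function_def L_def)
  have x: "x \<alpha> = (1 - u) * x \<alpha>1 + u * x \<alpha>2"
    by (simp add: x_def u(4) sum_distrib_left sum.distrib distrib_right mult.assoc)
  have "(1 - u) * (T1 * L T1 \<alpha>1) + u * (T2 * L T2 \<alpha>2) =
      ((((1 - u) * T1 + u * T2) / T) * (h - x \<alpha>) - (h - ((1 - u) * x \<alpha>1 + u * x \<alpha>2))) / boltz M"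
    unfolding L(2)[OF T(1)] L(2)[OF T(2)] using Tpos boltz_pos by (simp add: field_simps)
  also have "\<dots> = 0"
    unfolding x[symmetric] u(3)[symmetric] using Tpos by simp
  finally have "0 = (1 - u) * (T1 * L T1 \<alpha>1) + u * (T2 * L T2 \<alpha>2)" ..
  also have "\<dots> \<le> (1 - u) * (T1 * (1 - partition_function M T \<alpha>)) + u * (T2 * (1 - partition_function M T \<alpha>))"
    using u T ineq[OF dom(1) T(1) Z(1)] ineq[OF dom(2) T(2) Z(2)]
    by (intro add_mono mult_left_mono) auto
  also have "\<dots> = T * (1 - partition_function M T \<alpha>)"
    unfolding u(3) by algebra
  finally show ?thesis using Tpos by (simp add: zero_le_mult_iff)
qed

end

section \<open>Regular parameters\<close>

text \<open>
  The components outside \<open>Idx\<close>, on which nothing depends, are fixed, since otherwise a maximizer on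
  the sublevel set could not be unique.
\<close>
definition sublevel :: "('e::ring_1, 'j::finite) thermal \<Rightarrow> real ^ 'j \<Rightarrow> (real \<times> (real ^ 'j)) set" where
  "sublevel M \<alpha>0 = {(T, \<alpha>). (T, \<alpha>) \<in> Delta_dom M \<and> 0 < T \<and> partition_function M T \<alpha> \<le> 1 \<and>
     (\<forall>j. j \<notin> Idx M \<longrightarrow> \<alpha> $ j = \<alpha>0 $ j)}"

text \<open>Collects the local facts used near a thermal state, at every parameter point and not
  only at the thermal one. The ball is closed for the sake of compactness.\<close>

definition regular_ball :: "('e::ring_1, 'j::finite) thermal \<Rightarrow> real \<times> (real ^ 'j) \<Rightarrow> real \<Rightarrow> bool" where
  "regular_ball M p0 R \<longleftrightarrow> R > 0 \<and> (\<forall>(T, \<alpha>)\<in>cball p0 R. (T, \<alpha>) \<in> Delta_dom M \<and> 0 < T \<and>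
     (\<lambda>(T, \<alpha>). partition_function M T \<alpha>) differentiable at (T, \<alpha>) \<and>
     integrable_against M (qexp M (gibbs_exponent M T \<alpha>)))"

context thermal_system
begin

text \<open>Solves \<open>-1/(kT') = -1/(kT) + uc\<close> and
  \<open>\<alpha>'/(kT') = \<alpha>/(kT) + ub\<close> for the parameters: a straight line of
  exponents is a curve in \<open>(T, \<alpha>)\<close>.\<close>

lemma gibbs_exponent_shift:
  assumes T: "T \<noteq> 0" "1 - u * c * boltz M * T \<noteq> 0"
    and T': "T' = T / (1 - u * c * boltz M * T)"
    and \<alpha>': "\<alpha>' = (boltz M * T') *\<^sub>R ((1 / (boltz M * T)) *\<^sub>R \<alpha> + u *\<^sub>R b)"
  shows "gibbs_exponent M T' \<alpha>' = gibbs_exponent M T \<alpha> + rscale M u (rscale M c (Ham M) + dotX M b)"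
proof -
  have T'0: "T' \<noteq> 0" using T T' by simp
  have 1: "- 1 / (boltz M * T') = - 1 / (boltz M * T) + u * c"
    unfolding T' using T boltz_nonzero by (simp add: field_simps)
  have 2: "(1 / (boltz M * T')) *\<^sub>R \<alpha>' = (1 / (boltz M * T)) *\<^sub>R \<alpha> + u *\<^sub>R b"
    unfolding \<alpha>' using T'0 boltz_nonzero by simp
  show ?thesis
    unfolding gibbs_exponent_affine 1 2
    by (simp add: rs.scale_left_distrib rs.scale_right_distrib dotX_add dotX_scaleR algebra_simps)
qed

text \<open>The chain rule yields integrability of \<open>e^f g\<close> once the integral of
  \<open>e^(f + ug)\<close> is differentiable at u = 0. That line of exponents is lifted to a
  differentiable parameter curve, along which the partition function is differentiable.\<close>

lemma integrable_direction:
  assumes N: "open N" "(T, \<alpha>) \<in> N" "N \<subseteq> Delta_dom M"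
    and diff: "(\<lambda>(T, \<alpha>). partition_function M T \<alpha>) differentiable at (T, \<alpha>)"
  shows "qexp M (gibbs_exponent M T \<alpha>) * (rscale M c (Ham M) + dotX M b) \<in> Intg M"
proof -
  let ?g = "rscale M c (Ham M) + dotX M b" and ?f = "gibbs_exponent M T \<alpha>"
  have T: "T \<noteq> 0" using N by (auto simp: Delta_dom_iff)
  define t where "t u = T / (1 - u * c * boltz M * T)" for u
  define a where "a u = (boltz M * t u) *\<^sub>R ((1 / (boltz M * T)) *\<^sub>R \<alpha> + u *\<^sub>R b)" for u
  have t0: "t 0 = T" and a0: "a 0 = \<alpha>"
    using T boltz_nonzero by (simp_all add: t_def a_def)
  have td: "t differentiable at 0"
    unfolding t_def by (intro derivative_intros) auto
  then have "a differentiable at 0"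
    unfolding a_def by (intro derivative_intros) auto
  with td have cd: "(\<lambda>u. (t u, a u)) differentiable at 0"
    unfolding differentiable_def by (blast intro: has_derivative_Pair)
  have "\<forall>\<^sub>F u in at 0. (t u, a u) \<in> N"
    using differentiable_imp_continuous_within[OF cd] N(1,2)
    by (intro topological_tendstoD) (auto simp: continuous_within t0 a0)
  moreover have "\<forall>\<^sub>F u in at 0. 1 - u * c * boltz M * T \<noteq> 0"
  proof (rule tendsto_imp_eventually_ne)
    show "((\<lambda>u. 1 - u * c * boltz M * T) \<longlongrightarrow> 1 - 0 * c * boltz M * T) (at 0)"
      by (intro tendsto_intros)
  qed simp
  ultimately have "\<forall>\<^sub>F u in at 0. (t u, a u) \<in> N \<and> 1 - u * c * boltz M * T \<noteq> 0"
    by (rule eventually_conj)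
  then obtain \<epsilon> where \<epsilon>: "\<epsilon> > 0"
    "\<And>u. u \<noteq> 0 \<Longrightarrow> \<bar>u\<bar> < \<epsilon> \<Longrightarrow> (t u, a u) \<in> N \<and> 1 - u * c * boltz M * T \<noteq> 0"
    by (auto simp: eventually_at dist_real_def)
  have near: "(t u, a u) \<in> Delta_dom M" "gibbs_exponent M (t u) (a u) = ?f + rscale M u ?g"
    if "\<bar>u\<bar> < \<epsilon>" for u
  proof -
    \<comment> \<open>The punctured neighbourhood omits u = 0, where the curve is at
      \<open>(T, \<alpha>)\<close> itself.\<close>
    have *: "(t u, a u) \<in> N \<and> 1 - u * c * boltz M * T \<noteq> 0"
      using \<epsilon>(2)[OF _ that] N(2) by (cases "u = 0") (auto simp: t0 a0)
    then show "(t u, a u) \<in> Delta_dom M" using N(3) by auto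
    show "gibbs_exponent M (t u) (a u) = ?f + rscale M u ?g"
      using * by (intro gibbs_exponent_shift[OF T]) (auto simp: t_def a_def)
  qed
  have "(\<lambda>u. partition_function M (t u) (a u)) differentiable at 0"
    using differentiable_chain_at[OF cd, of "\<lambda>(T, \<alpha>). partition_function M T \<alpha>"] diff
    by (simp add: t0 a0 o_def)
  then obtain D where "((\<lambda>u. partition_function M (t u) (a u)) has_derivative D) (at 0)"
    by (auto simp: differentiable_def)
  then have "((\<lambda>u. complex_of_real (partition_function M (t u) (a u))) has_derivative
      (\<lambda>h. complex_of_real (D h))) (at 0)"
    by (rule has_derivative_of_real)
  then have "((\<lambda>u. integ M (qexp M (?f + rscale M u ?g))) has_derivative (\<lambda>h. complex_of_real (D h))) (at 0)"
  proof (rule has_derivative_transform_within_open)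
    show "open {-\<epsilon><..<\<epsilon>}" "0 \<in> {-\<epsilon><..<\<epsilon>}" using \<epsilon> by auto
    show "complex_of_real (partition_function M (t u) (a u)) = integ M (qexp M (?f + rscale M u ?g))"
      if "u \<in> {-\<epsilon><..<\<epsilon>}" for u
    proof -
      have u: "\<bar>u\<bar> < \<epsilon>" using that by auto
      show ?thesis using partition_function_pos(2)[OF near(1)[OF u]] near(2)[OF u] by simp
    qed
  qed
  then have "(\<lambda>u. integ M (qexp M (?f + rscale M u ?g))) differentiable at 0"
    by (auto simp: differentiable_def)
  moreover have "qexp M (?f + rscale M u ?g) \<in> SI M" if "\<bar>u\<bar> < \<epsilon>" for u
    using near[OF that] by (simp add: Delta_dom_iff)
  moreover have "hermitian M ?g"
    by (intro hermitian_add hermitian_rscale Ham_hermitian hermitian_dotX)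
  ultimately show ?thesis
    using integ_chain[OF hermitian_gibbs_exponent, of ?g \<epsilon> T \<alpha>] \<epsilon>(1) by blast
qed

text \<open>Differentiability passes from \<open>Delta\<close> to Z through Z =
  exp(\<Delta>/(\<kappa>T)); applying \<open>integrable_direction\<close> to the coordinate
  directions then gives the integrals of H and each X_j.\<close>

lemma regular_ball_exists:
  assumes reg: "regular_at M T0 \<alpha>0" and T0: "T0 > 0"
  obtains R where "regular_ball M (T0, \<alpha>0) R"
proof -
  obtain N where N: "open N" "(T0, \<alpha>0) \<in> N" "N \<subseteq> Delta_dom M"
    and C2: "C2_on N (\<lambda>(T, \<alpha>). Delta M T \<alpha>)"
    using reg unfolding regular_at_def by blast
  define N' where "N' = N \<inter> {p. 0 < fst p}"
  have "open N'" unfolding N'_def using N(1)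
    by (intro open_Int open_Collect_less continuous_intros)
  moreover have "(T0, \<alpha>0) \<in> N'" using N T0 by (simp add: N'_def)
  ultimately obtain R where R: "R > 0" "cball (T0, \<alpha>0) R \<subseteq> N'"
    using open_contains_cball by blast
  have diff: "(\<lambda>(T, \<alpha>). partition_function M T \<alpha>) differentiable at (T, \<alpha>)"
    if p: "(T, \<alpha>) \<in> N'" for T \<alpha>
  proof -
    obtain D where D: "((\<lambda>p. Delta M (fst p) (snd p)) has_derivative D) (at (T, \<alpha>))"
      using C2 p unfolding C2_on_def N'_def by (auto simp: case_prod_unfold)
    have "T > 0" using p by (simp add: N'_def)
    then have "(\<lambda>p. Delta M (fst p) (snd p) / (kappa M * fst p)) differentiable at (T, \<alpha>)"
      using D kappa_pos bounded_linear_imp_differentiable[OF bounded_linear_fst]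
      by (intro derivative_intros) (auto simp: differentiable_def[of "\<lambda>p. Delta M (fst p) (snd p)"])
    then obtain D' where "((\<lambda>p. Delta M (fst p) (snd p) / (kappa M * fst p)) has_derivative D') (at (T, \<alpha>))"
      by (auto simp: differentiable_def)
    then have "((\<lambda>p. exp (Delta M (fst p) (snd p) / (kappa M * fst p))) has_derivative
        (\<lambda>h. D' h * exp (Delta M T \<alpha> / (kappa M * T)))) (at (T, \<alpha>))"
      using DERIV_compose_FDERIV[OF DERIV_exp] by fastforce
    then have "((\<lambda>(T, \<alpha>). partition_function M T \<alpha>) has_derivative
        (\<lambda>h. D' h * exp (Delta M T \<alpha> / (kappa M * T)))) (at (T, \<alpha>))"
    proof (rule has_derivative_transform_within_open[OF _ \<open>open N'\<close> p])
      fix q assume "q \<in> N'"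
      then have "(fst q, snd q) \<in> Delta_dom M" "0 < fst q" using N(3) by (auto simp: N'_def)
      then show "exp (Delta M (fst q) (snd q) / (kappa M * fst q)) = (\<lambda>(T, \<alpha>). partition_function M T \<alpha>) q"
        using partition_function_pos(1)[of "fst q" "snd q"] kappa_pos
        by (simp add: Delta_eq case_prod_unfold)
    qed
    then show ?thesis by (auto simp: differentiable_def)
  qed
  have int: "integrable_against M (qexp M (gibbs_exponent M T \<alpha>))" if p: "(T, \<alpha>) \<in> N'" for T \<alpha>
  proof -
    have N': "N' \<subseteq> Delta_dom M" using N(3) by (auto simp: N'_def)
    note dir = integrable_direction[OF \<open>open N'\<close> p N' diff[OF p]]
    have "dotX M 0 = 0" by (simp add: dotX_def)
    then have "qexp M (gibbs_exponent M T \<alpha>) * Ham M \<in> Intg M"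
      using dir[of 1 0] by simp
    moreover have "qexp M (gibbs_exponent M T \<alpha>) * Ext M j \<in> Intg M" if "j \<in> Idx M" for j
    proof -
      have "dotX M (axis j 1) = (\<Sum>i\<in>Idx M. if i = j then Ext M i else 0)"
        unfolding dotX_def by (intro sum.cong) (auto simp: axis_def)
      also have "\<dots> = Ext M j" using that by simp
      finally show ?thesis using dir[of 0 "axis j 1"] by simp
    qed
    ultimately show ?thesis by (simp add: integrable_against_def)
  qed
  have "regular_ball M (T0, \<alpha>0) R"
    unfolding regular_ball_def using R diff int N(3) by (fastforce simp: N'_def)
  then show ?thesis using that by blast
qed

end

section \<open>The sublevel set of the partition function\<close>

lemma dist_Pair_le: "dist (a, b) (c, d) \<le> dist a c + dist b d"
  unfolding dist_Pair_Pair by (intro sqrt_sum_squares_le_sum) auto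

locale regular_thermal_state = thermal_system M
  for M :: "('e::ring_1, 'j::finite) thermal" +
  fixes S :: 'e and T0 :: real and \<alpha>0 :: "real ^ 'j" and R :: real
  assumes T0_pos: "T0 > 0" and thermal: "thermal_state M T0 \<alpha>0 S" and vals: "has_values M S"
    and indep: "independent_variables M" and reg: "regular_ball M (T0, \<alpha>0) R"
begin

text \<open>For \<open>x\<close> in \<open>Y\<close>, the inner product of
  \<open>(T, \<alpha>)\<close> with \<open>(s, x)\<close> is
  \<open>T * s + dot M \<alpha> x\<close>; this makes the potentials support functions of
  \<open>C\<close> and of its slices at fixed temperature.\<close>

abbreviation "p0 \<equiv> (T0, \<alpha>0)"
abbreviation "y0 \<equiv> (Sbar M S, Xbar M S)"
abbreviation "C \<equiv> sublevel M \<alpha>0"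
abbreviation "Z \<equiv> \<lambda>(T, \<alpha>). partition_function M T \<alpha>"
abbreviation "Y \<equiv> {x :: real ^ 'j. \<forall>j. j \<notin> Idx M \<longrightarrow> x $ j = 0}"

lemma R_pos: "R > 0"
  using reg by (simp add: regular_ball_def)

lemma ballD:
  assumes "p \<in> cball p0 R"
  shows "p \<in> Delta_dom M" "0 < fst p" "Z differentiable at p"
    "integrable_against M (qexp M (gibbs_exponent M (fst p) (snd p)))"
  using reg assms unfolding regular_ball_def by (auto simp del: mem_cball)

lemma base_in_sublevel: "p0 \<in> C"
  using thermal_stateD(4,5)[OF thermal] T0_pos by (simp add: sublevel_def)

text \<open>Membership in \<open>Delta_dom\<close> and T > 0 are not closed conditions, but they
  hold throughout the ball; the remaining conditions are closed.\<close>

lemma compact_sublevel: "compact (C \<inter> cball p0 R)"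
proof -
  have "continuous_on (cball p0 R) Z"
    using ballD(3) by (meson continuous_at_imp_continuous_on differentiable_imp_continuous_within)
  then have "closed {p \<in> cball p0 R. Z p \<le> 1}"
    by (intro continuous_on_closed_Collect_le continuous_on_const closed_cball)
  moreover have "closed (\<Inter>j\<in>- Idx M. {p :: real \<times> (real ^ 'j). snd p $ j = \<alpha>0 $ j})"
    by (intro closed_INT ballI closed_Collect_eq continuous_intros)
  ultimately have "closed ({p \<in> cball p0 R. Z p \<le> 1} \<inter> (\<Inter>j\<in>- Idx M. {p. snd p $ j = \<alpha>0 $ j}))"
    by (rule closed_Int)
  also have "{p \<in> cball p0 R. Z p \<le> 1} \<inter> (\<Inter>j\<in>- Idx M. {p. snd p $ j = \<alpha>0 $ j}) = C \<inter> cball p0 R"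
    using ballD(1,2) by (force simp: sublevel_def)
  finally show ?thesis
    by (auto simp: compact_eq_bounded_closed intro: bounded_subset[OF bounded_cball])
qed

lemma compact_slice:
  assumes "\<bar>T - T0\<bar> + r \<le> R"
  shows "compact ({\<alpha>. (T, \<alpha>) \<in> C} \<inter> cball \<alpha>0 r)"
proof -
  have "(T, \<alpha>) \<in> cball p0 R" if "\<alpha> \<in> cball \<alpha>0 r" for \<alpha>
    using dist_Pair_le[of T0 \<alpha>0 T \<alpha>] that assms by (simp add: dist_real_def abs_minus_commute)
  then have eq: "{\<alpha>. (T, \<alpha>) \<in> C} \<inter> cball \<alpha>0 r = snd ` ((C \<inter> cball p0 R) \<inter> ({T} \<times> cball \<alpha>0 r))"
    by force
  have "compact ((C \<inter> cball p0 R) \<inter> ({T} \<times> cball \<alpha>0 r))"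
    by (intro compact_Int_closed compact_sublevel closed_Times) auto
  then show ?thesis
    unfolding eq by (intro compact_continuous_image continuous_intros)
qed

lemma sublevel_segment:
  assumes p: "p1 \<in> C" "p2 \<in> C" and q: "q \<in> closed_segment p1 p2" "q \<in> cball p0 R"
  shows "q \<in> C"
proof -
  obtain T1 \<alpha>1 T2 \<alpha>2 T \<alpha> where e: "p1 = (T1, \<alpha>1)" "p2 = (T2, \<alpha>2)" "q = (T, \<alpha>)"
    by (cases p1, cases p2, cases q) auto
  obtain u where u: "0 \<le> u" "u \<le> 1" "T = (1 - u) * T1 + u * T2" "\<alpha> = (1 - u) *\<^sub>R \<alpha>1 + u *\<^sub>R \<alpha>2"
    using q(1) unfolding e in_segment by auto
  have "partition_function M T \<alpha> \<le> 1"
  proof (rule partition_function_convex[OF _ _ _ _ _ _ _ _ u])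
    show "(T, \<alpha>) \<in> Delta_dom M" "integrable_against M (qexp M (gibbs_exponent M T \<alpha>))"
      using ballD[OF q(2)] by (auto simp: e)
  qed (use p in \<open>auto simp: e sublevel_def\<close>)
  moreover have "\<alpha> $ j = \<alpha>0 $ j" if "j \<notin> Idx M" for j
    using p that by (simp add: u(4) e sublevel_def algebra_simps)
  ultimately show ?thesis
    using ballD(1,2)[OF q(2)] by (simp add: e sublevel_def)
qed

lemma sublevel_room:
  assumes p: "p \<in> C" "Z p \<noteq> 1" "dist p0 p < R" and y: "snd y \<in> Y"
  shows "\<exists>t>0. p + t *\<^sub>R y \<in> C"
proof -
  have "isCont Z p"
    using ballD(3)[of p] p(3) by (intro differentiable_imp_continuous_within) auto
  then have "(Z \<longlongrightarrow> Z p) (nhds p)"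
    by (simp only: isCont_def tendsto_at_iff_tendsto_nhds)
  moreover have "Z p < 1" using p(1,2) by (auto simp: sublevel_def)
  ultimately have "\<forall>\<^sub>F q in nhds p. Z q < 1"
    by (rule order_tendstoD)
  moreover have "\<forall>\<^sub>F q in nhds p. q \<in> ball p0 R"
    using p(3) by (intro eventually_nhds_in_open) auto
  ultimately have "\<forall>\<^sub>F q in nhds p. Z q < 1 \<and> q \<in> ball p0 R"
    by (rule eventually_conj)
  then obtain d where d: "d > 0" "\<And>q. dist q p < d \<Longrightarrow> Z q < 1 \<and> q \<in> ball p0 R"
    by (auto simp: eventually_nhds_metric)
  \<comment> \<open>The added 1 avoids a division by zero when y = 0.\<close>
  define t where "t = d / (2 * (norm y + 1))"
  have ny: "0 < norm y + 1" by (rule add_nonneg_pos) auto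
  then have t: "t > 0" using d by (simp add: t_def)
  have "norm (t *\<^sub>R y) < d"
    using ny d(1) by (simp add: t_def field_simps) (smt (verit) mult_nonneg_nonneg norm_ge_zero)
  then have q: "Z (p + t *\<^sub>R y) < 1 \<and> p + t *\<^sub>R y \<in> ball p0 R"
    by (intro d(2)) (simp add: dist_norm)
  then have "p + t *\<^sub>R y \<in> cball p0 R" by auto
  from ballD(1,2)[OF this] have "p + t *\<^sub>R y \<in> C"
    using q p(1) y by (cases p; cases y) (auto simp: sublevel_def)
  then show ?thesis using t by blast
qed

lemma gibbs: "gibbs_state M S"
  using thermal_stateD(1)[OF thermal] .

lemma inner_y0: "(T, \<alpha>) \<bullet> y0 = T * Sbar M S + dot M \<alpha> (Xbar M S)"
  by (simp add: dot_eq_inner Xbar_outside)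

lemma inner_diff_y0: "((T, \<alpha>) - p0) \<bullet> y0 = T * Sbar M S + dot M \<alpha> (Xbar M S) - Hbar M S"
  unfolding inner_diff_left inner_y0 using thermal_euler[OF thermal vals] by simp

text \<open>Linear independence enters here: it recovers the parameters from the entropy, up to
  components outside \<open>Idx\<close>, which \<open>out\<close> fixes.\<close>

lemma entropy_inj:
  assumes eq: "thermal_entropy M T \<alpha> = thermal_entropy M T0 \<alpha>0" and T: "T > 0"
    and out: "\<And>j. j \<notin> Idx M \<Longrightarrow> \<alpha> $ j = \<alpha>0 $ j"
  shows "(T, \<alpha>) = p0"
proof -
  have "rscale M (1 / T - 1 / T0) (Ham M) + dotX M ((1 / T0) *\<^sub>R \<alpha>0 - (1 / T) *\<^sub>R \<alpha>) =
      thermal_entropy M T \<alpha> - thermal_entropy M T0 \<alpha>0"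
    by (simp add: thermal_entropy_def dotX_diff dotX_scaleR rs.scale_left_diff_distrib
        rs.scale_right_diff_distrib algebra_simps)
  also have "\<dots> = 0" using eq by simp
  finally have ind: "1 / T - 1 / T0 = 0" "\<And>j. j \<in> Idx M \<Longrightarrow> ((1 / T0) *\<^sub>R \<alpha>0 - (1 / T) *\<^sub>R \<alpha>) $ j = 0"
    using indep unfolding independent_variables_def by blast+
  then have "T = T0" using T T0_pos by (simp add: field_simps)
  then have "\<alpha> $ j = \<alpha>0 $ j" for j
    using ind(2)[of j] out[of j] T by (cases "j \<in> Idx M") auto
  then show ?thesis using \<open>T = T0\<close> by (simp add: vec_eq_iff)
qed

lemma strict_max:
  assumes "p \<in> C" "p \<noteq> p0"
  shows "(p - p0) \<bullet> y0 < 0"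
proof -
  obtain T \<alpha> where p: "p = (T, \<alpha>)" by (cases p)
  have dom: "(T, \<alpha>) \<in> Delta_dom M" "T > 0" "partition_function M T \<alpha> \<le> 1"
    and out: "\<And>j. j \<notin> Idx M \<Longrightarrow> \<alpha> $ j = \<alpha>0 $ j"
    using assms(1) by (auto simp: p sublevel_def)
  have "T * Sbar M S + dot M \<alpha> (Xbar M S) \<noteq> Hbar M S"
  proof
    assume "T * Sbar M S + dot M \<alpha> (Xbar M S) = Hbar M S"
    from value_le(2)[OF gibbs vals dom this] thermal_stateD(3)[OF thermal]
    have "thermal_entropy M T \<alpha> = thermal_entropy M T0 \<alpha>0" by simp
    from entropy_inj[OF this dom(2) out] show False using assms(2) by (simp add: p)
  qed
  then show ?thesis
    using value_le(1)[OF gibbs vals dom] unfolding p inner_diff_y0 by linarith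
qed

text \<open>Gibbs' inequality makes \<open>p0\<close> a minimum of \<open>kT(Z - 1) - (p - p0)\<cdot>y0\<close>.\<close>
lemma partition_function_derivative:
  "(Z has_derivative (\<lambda>h. (h \<bullet> y0) / (boltz M * T0))) (at p0)"
proof -
  have p0: "p0 \<in> cball p0 R" using R_pos by simp
  obtain D where D: "(Z has_derivative D) (at p0)"
    using ballD(3)[OF p0] by (auto simp: differentiable_def)
  have Z0: "Z p0 = 1" using thermal_stateD(5)[OF thermal] by simp
  define G where "G p = boltz M * fst p * (Z p - 1) - (p - p0) \<bullet> y0" for p
  \<comment> \<open>Because Z = 1 at \<open>p0\<close>, the derivative of the factor
    \<open>boltz M * fst p\<close> contributes nothing.\<close>
  have "(G has_derivative (\<lambda>h. boltz M * T0 * D h - h \<bullet> y0)) (at p0)"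
    unfolding G_def
    by (rule derivative_eq_intros D | simp add: Z0[simplified] algebra_simps)+
  moreover have "\<forall>p\<in>ball p0 R. G p0 \<le> G p"
  proof
    fix p assume "p \<in> ball p0 R"
    then have "p \<in> cball p0 R" by auto
    note b = ballD(1,2)[OF this]
    obtain T \<alpha> where p: "p = (T, \<alpha>)" by (cases p)
    have "(p - p0) \<bullet> y0 / (boltz M * T) \<le> Z p - 1"
      using gibbs_inequality(1)[OF gibbs vals, of T \<alpha>] b unfolding p inner_diff_y0 by simp
    then have "0 \<le> G p"
      using b boltz_pos by (simp add: G_def p pos_divide_le_eq mult.commute)
    then show "G p0 \<le> G p" using Z0 by (simp add: G_def)
  qed
  ultimately have "(\<lambda>h. boltz M * T0 * D h - h \<bullet> y0) = (\<lambda>h. 0)"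
    using R_pos by (intro differential_zero_maxmin[of p0 "ball p0 R" G]) auto
  then have "boltz M * T0 * D h - h \<bullet> y0 = 0" for h
    by metis
  then have "D = (\<lambda>h. (h \<bullet> y0) / (boltz M * T0))"
    using boltz_pos T0_pos by (auto simp: field_simps)
  with D show ?thesis by simp
qed

end

section \<open>Differentiability of the potentials\<close>

lemma vec_upd_eq: "vec_upd x j y = x + (y - x $ j) *\<^sub>R axis j 1"
  by (simp add: vec_upd_def vec_eq_iff axis_def)

lemma vec_upd_self: "vec_upd x j (x $ j) = x"
  by (simp add: vec_upd_def vec_eq_iff)

lemma dist_vec_upd: "dist (vec_upd x j y) x = \<bar>y - x $ j\<bar>"
  by (simp add: vec_upd_eq dist_norm)

lemma dot_vec_upd:
  assumes "j \<in> Idx M"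
  shows "dot M \<alpha> (vec_upd x j y) = dot M \<alpha> x + \<alpha> $ j * (y - x $ j)"
proof -
  have "dot M \<alpha> (vec_upd x j y) =
      (\<Sum>i\<in>Idx M. \<alpha> $ i * x $ i + (if i = j then \<alpha> $ j * (y - x $ j) else 0))"
    unfolding dot_def by (intro sum.cong) (auto simp: vec_upd_def algebra_simps)
  then show ?thesis using assms by (simp add: sum.distrib dot_def)
qed

context regular_thermal_state
begin

text \<open>The potentials leave the components outside \<open>Idx\<close> free while
  \<open>C\<close> freezes them; overwriting them by those of \<open>\<alpha>0\<close> changes
  neither the exponent nor the value.\<close>

lemma feasible_in_sublevel:
  assumes "(T, \<alpha>) \<in> Delta_dom M" "Delta M T \<alpha> = 0" "T > 0"
  obtains \<beta> where "(T, \<beta>) \<in> C" "\<And>x. x \<in> Y \<Longrightarrow> dot M \<alpha> x = \<beta> \<bullet> x"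
proof -
  define \<beta> where "\<beta> = (\<chi> j. if j \<in> Idx M then \<alpha> $ j else \<alpha>0 $ j)"
  have "gibbs_exponent M T \<beta> = gibbs_exponent M T \<alpha>"
    unfolding gibbs_exponent_def by (subst dotX_cong[of M \<beta> \<alpha>]) (auto simp: \<beta>_def)
  then have "(T, \<beta>) \<in> C"
    using assms Delta_eq_0_iff[OF assms(1)]
    by (simp add: sublevel_def Delta_dom_iff partition_function_def \<beta>_def)
  moreover have "dot M \<alpha> x = \<beta> \<bullet> x" if "x \<in> Y" for x
  proof -
    have "dot M \<alpha> x = dot M \<beta> x" by (simp add: dot_def \<beta>_def)
    then show ?thesis using that by (simp add: dot_eq_inner)
  qed
  ultimately show ?thesis using that by blast
qed

text \<open>The relaxation is exact once its maximizer satisfies Z = 1: the maximizer is feasible,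
  and all feasible points have representatives in \<open>C\<close>.\<close>

lemma U_pot_eq:
  assumes m: "m \<in> C" "Z m = 1" "\<And>p. p \<in> C \<Longrightarrow> p \<bullet> (s, x) \<le> m \<bullet> (s, x)" and x: "x \<in> Y"
  shows "U_defined M s x" "U_pot M s x = m \<bullet> (s, x)"
proof -
  obtain T \<alpha> where mT: "m = (T, \<alpha>)" by (cases m)
  have dom: "(T, \<alpha>) \<in> Delta_dom M" "T > 0" using m(1) by (auto simp: mT sublevel_def)
  then have "Delta M T \<alpha> = 0" using m(2) by (simp add: Delta_eq_0_iff mT)
  moreover have "m \<bullet> (s, x) = T * s + dot M \<alpha> x"
    using x by (simp add: mT dot_eq_inner)
  ultimately have "m \<bullet> (s, x) \<in> U_values M s x"
    using dom unfolding U_values_def by blast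
  moreover have "w \<le> m \<bullet> (s, x)" if w_in: "w \<in> U_values M s x" for w
  proof -
    obtain T' \<alpha>' where w: "w = T' * s + dot M \<alpha>' x"
      and f: "(T', \<alpha>') \<in> Delta_dom M" "Delta M T' \<alpha>' = 0" "T' > 0"
      using w_in unfolding U_values_def by blast
    obtain \<beta> where \<beta>: "(T', \<beta>) \<in> C" "\<And>x. x \<in> Y \<Longrightarrow> dot M \<alpha>' x = \<beta> \<bullet> x"
      using feasible_in_sublevel[OF f] by blast
    show ?thesis using m(3)[OF \<beta>(1)] \<beta>(2)[OF x] by (simp add: w)
  qed
  ultimately show "U_defined M s x" "U_pot M s x = m \<bullet> (s, x)"
    unfolding U_defined_def U_pot_def by (auto intro!: maximumI)
qed

lemma A_pot_eq:
  assumes m: "(T, \<alpha>) \<in> C" "Z (T, \<alpha>) = 1" "\<And>\<beta>. (T, \<beta>) \<in> C \<Longrightarrow> \<beta> \<bullet> x \<le> \<alpha> \<bullet> x" and x: "x \<in> Y"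
  shows "A_defined M T x" "A_pot M T x = \<alpha> \<bullet> x"
proof -
  have dom: "(T, \<alpha>) \<in> Delta_dom M" "T > 0" using m(1) by (auto simp: sublevel_def)
  then have "Delta M T \<alpha> = 0" using m(2) by (simp add: Delta_eq_0_iff)
  moreover have "\<alpha> \<bullet> x = dot M \<alpha> x"
    using x by (simp add: dot_eq_inner)
  ultimately have "\<alpha> \<bullet> x \<in> A_values M T x"
    using dom unfolding A_values_def by blast
  moreover have "w \<le> \<alpha> \<bullet> x" if w_in: "w \<in> A_values M T x" for w
  proof -
    obtain \<alpha>' where w: "w = dot M \<alpha>' x"
      and f: "(T, \<alpha>') \<in> Delta_dom M" "Delta M T \<alpha>' = 0"
      using w_in unfolding A_values_def by blast
    obtain \<beta> where \<beta>: "(T, \<beta>) \<in> C" "\<And>x. x \<in> Y \<Longrightarrow> dot M \<alpha>' x = \<beta> \<bullet> x"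
      using feasible_in_sublevel[OF f dom(2)] by blast
    show ?thesis using m(3)[OF \<beta>(1)] \<beta>(2)[OF x] by (simp add: w)
  qed
  ultimately show "A_defined M T x" "A_pot M T x = \<alpha> \<bullet> x"
    unfolding A_defined_def A_pot_def by (auto intro!: maximumI)
qed

section \<open>The Hamilton potential near a thermal state\<close>

lemma Xbar_Y: "Xbar M S \<in> Y"
  by (simp add: Xbar_outside)

text \<open>The lower estimate holds because \<open>p0\<close> competes at every argument; the upper
  one is the little-o bound for the maximizer.\<close>

lemma U_pot_differentiable:
  assumes "\<epsilon> > 0"
  obtains \<delta> where "\<delta> > 0" "\<And>s x. x \<in> Y \<Longrightarrow> dist (s, x) y0 < \<delta> \<Longrightarrow>
    U_defined M s x \<and> \<bar>U_pot M s x - (T0 * s + dot M \<alpha>0 x)\<bar> \<le> \<epsilon> * dist (s, x) y0"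
proof -
  obtain \<delta> where \<delta>: "\<delta> > 0" "\<And>y. y \<in> {y. snd y \<in> Y} \<Longrightarrow> dist y y0 < \<delta> \<Longrightarrow>
      \<exists>m\<in>C \<inter> {p. Z p = 1}. (\<forall>p\<in>C. p \<bullet> y \<le> m \<bullet> y) \<and> m \<bullet> y \<le> p0 \<bullet> y + \<epsilon> * dist y y0"
  proof (rule support_function_derivative[OF base_in_sublevel R_pos compact_sublevel _ _ _ _ assms])
    show "q \<in> C" if "p \<in> C" "q \<in> closed_segment p0 p" "q \<in> cball p0 R" for p q
      using sublevel_segment[OF base_in_sublevel that] .
    show "(p - p0) \<bullet> y0 < 0" if "p \<in> C" "p \<noteq> p0" for p
      using strict_max that .
    show "p0 \<in> {p. Z p = 1}"
      using thermal_stateD(5)[OF thermal] by simp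
    show "\<exists>t>0. p + t *\<^sub>R y \<in> C"
      if "p \<in> C" "p \<notin> {p. Z p = 1}" "dist p0 p < R" "y \<in> {y. snd y \<in> Y}" for p y
      using sublevel_room[of p y] that by simp
  qed blast
  show ?thesis
  proof (rule that[OF \<delta>(1)])
    fix s x assume x: "x \<in> Y" and d: "dist (s, x) y0 < \<delta>"
    obtain m where m: "m \<in> C" "Z m = 1" "\<And>p. p \<in> C \<Longrightarrow> p \<bullet> (s, x) \<le> m \<bullet> (s, x)"
      "m \<bullet> (s, x) \<le> p0 \<bullet> (s, x) + \<epsilon> * dist (s, x) y0"
      using \<delta>(2)[OF _ d] x by auto
    have "p0 \<bullet> (s, x) = T0 * s + dot M \<alpha>0 x"
      using x by (simp add: dot_eq_inner)
    then show "U_defined M s x \<and> \<bar>U_pot M s x - (T0 * s + dot M \<alpha>0 x)\<bar> \<le> \<epsilon> * dist (s, x) y0"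
      using U_pot_eq[OF m(1-3) x] m(3)[OF base_in_sublevel] m(4) by simp
  qed
qed

lemma U_pot_at: "U_pot M (Sbar M S) (Xbar M S) = T0 * Sbar M S + dot M \<alpha>0 (Xbar M S)"
proof -
  obtain \<delta> where "\<delta> > 0" "\<And>s x. x \<in> Y \<Longrightarrow> dist (s, x) y0 < \<delta> \<Longrightarrow>
    U_defined M s x \<and> \<bar>U_pot M s x - (T0 * s + dot M \<alpha>0 x)\<bar> \<le> 1 * dist (s, x) y0"
    using U_pot_differentiable[of 1] by auto
  from this(1) this(2)[OF Xbar_Y, of "Sbar M S"] show ?thesis by simp
qed

lemma dU_dS_thermal: "dU_dS M (Sbar M S) (Xbar M S) T0"
  unfolding dU_dS_def
proof (rule partial_derivI)
  fix \<epsilon> :: real assume "\<epsilon> > 0"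
  then obtain \<delta> where \<delta>: "\<delta> > 0" "\<And>s x. x \<in> Y \<Longrightarrow> dist (s, x) y0 < \<delta> \<Longrightarrow>
    U_defined M s x \<and> \<bar>U_pot M s x - (T0 * s + dot M \<alpha>0 x)\<bar> \<le> \<epsilon> * dist (s, x) y0"
    using U_pot_differentiable by blast
  have "U_defined M s (Xbar M S) \<and> \<bar>U_pot M s (Xbar M S) - U_pot M (Sbar M S) (Xbar M S) -
      T0 * (s - Sbar M S)\<bar> \<le> \<epsilon> * \<bar>s - Sbar M S\<bar>" if "\<bar>s - Sbar M S\<bar> < \<delta>" for s
    using \<delta>(2)[OF Xbar_Y, of s] that
    by (simp add: dist_Pair_Pair dist_real_def U_pot_at algebra_simps)
  then show "\<exists>\<delta>>0. \<forall>s. \<bar>s - Sbar M S\<bar> < \<delta> \<longrightarrow> U_defined M s (Xbar M S) \<and>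
      \<bar>U_pot M s (Xbar M S) - U_pot M (Sbar M S) (Xbar M S) - T0 * (s - Sbar M S)\<bar> \<le> \<epsilon> * \<bar>s - Sbar M S\<bar>"
    using \<delta>(1) by blast
qed

lemma vec_upd_Xbar_Y: "j \<in> Idx M \<Longrightarrow> vec_upd (Xbar M S) j y \<in> Y"
  by (auto simp: vec_upd_def Xbar_outside)

lemma dU_dX_thermal:
  assumes j: "j \<in> Idx M"
  shows "dU_dX M j (Sbar M S) (Xbar M S) (\<alpha>0 $ j)"
  unfolding dU_dX_def
proof (rule partial_derivI)
  let ?X = "\<lambda>y. vec_upd (Xbar M S) j y" and ?x = "Xbar M S $ j"
  fix \<epsilon> :: real assume "\<epsilon> > 0"
  then obtain \<delta> where \<delta>: "\<delta> > 0" "\<And>s x. x \<in> Y \<Longrightarrow> dist (s, x) y0 < \<delta> \<Longrightarrow>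
    U_defined M s x \<and> \<bar>U_pot M s x - (T0 * s + dot M \<alpha>0 x)\<bar> \<le> \<epsilon> * dist (s, x) y0"
    using U_pot_differentiable by blast
  have "U_defined M (Sbar M S) (?X y) \<and> \<bar>U_pot M (Sbar M S) (?X y) - U_pot M (Sbar M S) (?X ?x) -
      \<alpha>0 $ j * (y - ?x)\<bar> \<le> \<epsilon> * \<bar>y - ?x\<bar>" if "\<bar>y - ?x\<bar> < \<delta>" for y
    using \<delta>(2)[OF vec_upd_Xbar_Y[OF j], of "Sbar M S" y] that
    by (simp add: dist_Pair_Pair dist_vec_upd vec_upd_self U_pot_at dot_vec_upd[OF j] algebra_simps)
  then show "\<exists>\<delta>>0. \<forall>y. \<bar>y - ?x\<bar> < \<delta> \<longrightarrow> U_defined M (Sbar M S) (?X y) \<and>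
      \<bar>U_pot M (Sbar M S) (?X y) - U_pot M (Sbar M S) (?X ?x) - \<alpha>0 $ j * (y - ?x)\<bar> \<le> \<epsilon> * \<bar>y - ?x\<bar>"
    using \<delta>(1) by blast
qed

section \<open>The Helmholtz potential at fixed temperature\<close>

lemma slice_strict_max:
  assumes "(T0, \<alpha>) \<in> C" "\<alpha> \<noteq> \<alpha>0"
  shows "(\<alpha> - \<alpha>0) \<bullet> Xbar M S < 0"
  using strict_max[OF assms(1)] assms(2) by simp

lemma A_pot_differentiable:
  assumes "\<epsilon> > 0"
  obtains \<delta> where "\<delta> > 0" "\<And>x. x \<in> Y \<Longrightarrow> dist x (Xbar M S) < \<delta> \<Longrightarrow>
    A_defined M T0 x \<and> \<bar>A_pot M T0 x - dot M \<alpha>0 x\<bar> \<le> \<epsilon> * dist x (Xbar M S)"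
proof -
  let ?C = "{\<alpha>. (T0, \<alpha>) \<in> C}"
  obtain \<delta> where \<delta>: "\<delta> > 0" "\<And>y. y \<in> Y \<Longrightarrow> dist y (Xbar M S) < \<delta> \<Longrightarrow>
      \<exists>m\<in>?C \<inter> {\<alpha>. Z (T0, \<alpha>) = 1}. (\<forall>p\<in>?C. p \<bullet> y \<le> m \<bullet> y) \<and> m \<bullet> y \<le> \<alpha>0 \<bullet> y + \<epsilon> * dist y (Xbar M S)"
  proof (rule support_function_derivative[OF _ R_pos _ _ _ _ _ assms])
    show "\<alpha>0 \<in> ?C" using base_in_sublevel by simp
    show "compact (?C \<inter> cball \<alpha>0 R)" using compact_slice[of T0 R] by simp
    show "q \<in> ?C" if "p \<in> ?C" "q \<in> closed_segment \<alpha>0 p" "q \<in> cball \<alpha>0 R" for p q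
    proof -
      have "(T0, q) \<in> closed_segment p0 (T0, p)"
        using that(2) by (auto simp: in_segment algebra_simps)
      then show ?thesis
        using sublevel_segment[OF base_in_sublevel, of "(T0, p)" "(T0, q)"] that(1,3)
        by (simp add: dist_Pair_Pair)
    qed
    show "(p - \<alpha>0) \<bullet> Xbar M S < 0" if "p \<in> ?C" "p \<noteq> \<alpha>0" for p
      using slice_strict_max that by simp
    show "\<alpha>0 \<in> {\<alpha>. Z (T0, \<alpha>) = 1}"
      using thermal_stateD(5)[OF thermal] by simp
    show "\<exists>t>0. p + t *\<^sub>R y \<in> ?C"
      if "p \<in> ?C" "p \<notin> {\<alpha>. Z (T0, \<alpha>) = 1}" "dist \<alpha>0 p < R" "y \<in> Y" for p y
      using sublevel_room[of "(T0, p)" "(0, y)"] that by (simp add: dist_Pair_Pair)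
  qed blast
  show ?thesis
  proof (rule that[OF \<delta>(1)])
    fix x assume x: "x \<in> Y" and d: "dist x (Xbar M S) < \<delta>"
    obtain m where m: "(T0, m) \<in> C" "Z (T0, m) = 1" "\<And>p. (T0, p) \<in> C \<Longrightarrow> p \<bullet> x \<le> m \<bullet> x"
      "m \<bullet> x \<le> \<alpha>0 \<bullet> x + \<epsilon> * dist x (Xbar M S)"
      using \<delta>(2)[OF x d] by auto
    have "\<alpha>0 \<bullet> x = dot M \<alpha>0 x"
      using x by (simp add: dot_eq_inner)
    then show "A_defined M T0 x \<and> \<bar>A_pot M T0 x - dot M \<alpha>0 x\<bar> \<le> \<epsilon> * dist x (Xbar M S)"
      using A_pot_eq[OF m(1-3) x] m(3)[OF base_in_sublevel] m(4) by simp
  qed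
qed

lemma A_pot_at: "A_pot M T0 (Xbar M S) = dot M \<alpha>0 (Xbar M S)"
proof -
  obtain \<delta> where "\<delta> > 0" "\<And>x. x \<in> Y \<Longrightarrow> dist x (Xbar M S) < \<delta> \<Longrightarrow>
    A_defined M T0 x \<and> \<bar>A_pot M T0 x - dot M \<alpha>0 x\<bar> \<le> 1 * dist x (Xbar M S)"
    using A_pot_differentiable[of 1] by auto
  from this(1) this(2)[OF Xbar_Y] show ?thesis by simp
qed

lemma dA_dX_thermal:
  assumes j: "j \<in> Idx M"
  shows "dA_dX M j T0 (Xbar M S) (\<alpha>0 $ j)"
  unfolding dA_dX_def
proof (rule partial_derivI)
  let ?X = "\<lambda>y. vec_upd (Xbar M S) j y" and ?x = "Xbar M S $ j"
  fix \<epsilon> :: real assume "\<epsilon> > 0"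
  then obtain \<delta> where \<delta>: "\<delta> > 0" "\<And>x. x \<in> Y \<Longrightarrow> dist x (Xbar M S) < \<delta> \<Longrightarrow>
    A_defined M T0 x \<and> \<bar>A_pot M T0 x - dot M \<alpha>0 x\<bar> \<le> \<epsilon> * dist x (Xbar M S)"
    using A_pot_differentiable by blast
  have "A_defined M T0 (?X y) \<and> \<bar>A_pot M T0 (?X y) - A_pot M T0 (?X ?x) -
      \<alpha>0 $ j * (y - ?x)\<bar> \<le> \<epsilon> * \<bar>y - ?x\<bar>" if "\<bar>y - ?x\<bar> < \<delta>" for y
    using \<delta>(2)[OF vec_upd_Xbar_Y[OF j], of y] that
    by (simp add: dist_vec_upd vec_upd_self A_pot_at dot_vec_upd[OF j] algebra_simps)
  then show "\<exists>\<delta>>0. \<forall>y. \<bar>y - ?x\<bar> < \<delta> \<longrightarrow> A_defined M T0 (?X y) \<and>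
      \<bar>A_pot M T0 (?X y) - A_pot M T0 (?X ?x) - \<alpha>0 $ j * (y - ?x)\<bar> \<le> \<epsilon> * \<bar>y - ?x\<bar>"
    using \<delta>(1) by blast
qed

section \<open>The Helmholtz potential under a change of temperature\<close>

text \<open>
  The point \<open>(T, \<alpha>0 + \<tau>\<cdot>Xbar)\<close> with \<open>\<tau>\<close> slightly below the solution of the linearized equation
  \<open>Z = 1\<close> is feasible, which bounds \<open>A\<close> from below; Gibbs' inequality bounds it from above.
\<close>
lemma sublevel_near_temperature:
  assumes X: "Xbar M S \<noteq> 0" and \<epsilon>: "\<epsilon> > 0"
  obtains \<delta> B where "\<delta> > 0" "\<And>T. \<bar>T - T0\<bar> < \<delta> \<Longrightarrow> \<exists>\<alpha>. (T, \<alpha>) \<in> C \<and>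
    (\<alpha> - \<alpha>0) \<bullet> Xbar M S = - Sbar M S * (T - T0) - \<epsilon> * \<bar>T - T0\<bar> \<and> dist \<alpha>0 \<alpha> \<le> B * \<bar>T - T0\<bar>"
proof -
  let ?X = "Xbar M S" and ?s = "Sbar M S"
  define B where "B = (\<bar>?s\<bar> + \<epsilon>) / norm ?X"
  have B: "B > 0" using X \<epsilon> by (simp add: B_def add_nonneg_pos)
  have kT: "boltz M * T0 > 0" using boltz_pos T0_pos by simp
  \<comment> \<open>Chosen so that the linearization error over a distance of
    \<open>(1 + B) * \<bar>T - T0\<bar>\<close> is at most the decrease
    \<open>\<epsilon> * \<bar>T - T0\<bar> / (boltz M * T0)\<close> built into
    \<open>w\<close>.\<close>
  define \<eta> where "\<eta> = \<epsilon> / (boltz M * T0 * (1 + B))"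
  have "\<eta> > 0" using \<epsilon> kT B by (simp add: \<eta>_def)
  then obtain d where d: "d > 0" "\<And>p. norm (p - p0) < d \<Longrightarrow>
      norm (Z p - Z p0 - ((p - p0) \<bullet> y0) / (boltz M * T0)) \<le> \<eta> * norm (p - p0)"
    using partition_function_derivative unfolding has_derivative_at_alt by blast
  define \<delta> where "\<delta> = min (d / (1 + B)) (R / (1 + B))"
  have "\<delta> > 0" using d R_pos B by (simp add: \<delta>_def)
  moreover have "\<exists>\<alpha>. (T, \<alpha>) \<in> C \<and> (\<alpha> - \<alpha>0) \<bullet> ?X = - ?s * (T - T0) - \<epsilon> * \<bar>T - T0\<bar> \<and>
      dist \<alpha>0 \<alpha> \<le> B * \<bar>T - T0\<bar>" if T: "\<bar>T - T0\<bar> < \<delta>" for T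
  proof -
    define w where "w = - ?s * (T - T0) - \<epsilon> * \<bar>T - T0\<bar>"
    define \<alpha> where "\<alpha> = \<alpha>0 + (w / (norm ?X)\<^sup>2) *\<^sub>R ?X"
    have X2: "?X \<bullet> ?X = (norm ?X)\<^sup>2" by (simp add: power2_norm_eq_inner)
    have ip: "(\<alpha> - \<alpha>0) \<bullet> ?X = w" using X by (simp add: \<alpha>_def X2)
    have "\<bar>w\<bar> \<le> (\<bar>?s\<bar> + \<epsilon>) * \<bar>T - T0\<bar>"
      using \<epsilon> abs_triangle_ineq4[of "- ?s * (T - T0)" "\<epsilon> * \<bar>T - T0\<bar>"]
      by (simp add: w_def abs_mult distrib_right)
    then have "\<bar>w\<bar> / norm ?X \<le> B * \<bar>T - T0\<bar>"
      using divide_right_mono[of "\<bar>w\<bar>" _ "norm ?X"] by (simp add: B_def)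
    moreover have "dist \<alpha>0 \<alpha> = \<bar>w\<bar> / norm ?X"
      using X by (simp add: \<alpha>_def dist_norm power2_eq_square)
    ultimately have dist: "dist \<alpha>0 \<alpha> \<le> B * \<bar>T - T0\<bar>" by simp
    have dp: "dist p0 (T, \<alpha>) \<le> (1 + B) * \<bar>T - T0\<bar>"
      using dist_Pair_le[of T0 \<alpha>0 T \<alpha>] dist by (simp add: dist_real_def abs_minus_commute distrib_right)
    have "(1 + B) * \<bar>T - T0\<bar> < d" "(1 + B) * \<bar>T - T0\<bar> < R"
      using T B by (simp_all add: \<delta>_def field_simps)
    moreover have np: "norm ((T, \<alpha>) - p0) = dist p0 (T, \<alpha>)"
      by (metis dist_norm dist_commute)
    ultimately have near: "norm ((T, \<alpha>) - p0) < d" "(T, \<alpha>) \<in> cball p0 R"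
      unfolding np mem_cball using dp by linarith+
    have "((T, \<alpha>) - p0) \<bullet> y0 = - (\<epsilon> * \<bar>T - T0\<bar>)"
      using ip by (simp add: w_def algebra_simps)
    moreover have "\<eta> * norm ((T, \<alpha>) - p0) \<le> \<epsilon> * \<bar>T - T0\<bar> / (boltz M * T0)"
    proof -
      have "\<eta> * norm ((T, \<alpha>) - p0) \<le> \<eta> * ((1 + B) * \<bar>T - T0\<bar>)"
        unfolding np using dp \<open>\<eta> > 0\<close> by (intro mult_left_mono) simp_all
      also have "\<dots> = \<epsilon> * \<bar>T - T0\<bar> / (boltz M * T0)"
        using B kT by (simp add: \<eta>_def)
      finally show ?thesis .
    qed
    moreover have "Z p0 = 1" using thermal_stateD(5)[OF thermal] by simp
    ultimately have "Z (T, \<alpha>) \<le> 1"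
      using d(2)[OF near(1)] by simp
    moreover have "\<alpha> $ j = \<alpha>0 $ j" if "j \<notin> Idx M" for j
      using that by (simp add: \<alpha>_def Xbar_outside)
    ultimately have "(T, \<alpha>) \<in> C"
      using ballD(1,2)[OF near(2)] by (simp add: sublevel_def)
    then show ?thesis using ip dist by (auto simp: w_def)
  qed
  ultimately show ?thesis using that by blast
qed

text \<open>For T \<noteq> T0 the point \<open>\<alpha>0\<close> need not lie in the slice of
  \<open>C\<close> at T, so the search starts from a nearby point \<open>\<alpha>1\<close> of that
  slice, in a ball still centred at \<open>\<alpha>0\<close>. The condition
  \<open>Xbar M S \<noteq> 0\<close> supplies \<open>\<alpha>1\<close> and the direction that pushes
  a maximizer onto Z = 1.\<close>

lemma dA_dT_thermal:
  assumes X: "Xbar M S \<noteq> 0"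
  shows "dA_dT M T0 (Xbar M S) (- Sbar M S)"
  unfolding dA_dT_def
proof (rule partial_derivI)
  let ?X = "Xbar M S" and ?s = "Sbar M S"
  fix \<epsilon> :: real assume \<epsilon>: "\<epsilon> > 0"
  obtain d B where d: "d > 0" "\<And>T. \<bar>T - T0\<bar> < d \<Longrightarrow> \<exists>\<alpha>. (T, \<alpha>) \<in> C \<and>
      (\<alpha> - \<alpha>0) \<bullet> ?X = - ?s * (T - T0) - \<epsilon> * \<bar>T - T0\<bar> \<and> dist \<alpha>0 \<alpha> \<le> B * \<bar>T - T0\<bar>"
    using sublevel_near_temperature[OF X \<epsilon>] by blast
  \<comment> \<open>One half of \<open>R\<close> is reserved for the change of T, the other for that
    of \<alpha>.\<close>
  define r where "r = R / 2"
  have r: "r > 0" using R_pos by (simp add: r_def)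
  have inball: "(T, \<alpha>) \<in> cball p0 R" if "\<bar>T - T0\<bar> \<le> r" "dist \<alpha>0 \<alpha> \<le> r" for T \<alpha>
    using dist_Pair_le[of T0 \<alpha>0 T \<alpha>] that by (simp add: r_def dist_real_def abs_minus_commute)
  \<comment> \<open>Only the \<alpha>-component is put on a sphere, so that the gap \<open>c\<close>
    is uniform in the temperature.\<close>
  define K where "K = (C \<inter> cball p0 R) \<inter> (UNIV \<times> sphere \<alpha>0 r)"
  have "compact K"
    unfolding K_def by (intro compact_Int_closed compact_sublevel closed_Times) auto
  moreover have "(q - p0) \<bullet> y0 < 0" if "q \<in> K" for q
    using strict_max[of q] that r by (auto simp: K_def)
  ultimately obtain c where c: "c > 0" "\<And>q. q \<in> K \<Longrightarrow> (q - p0) \<bullet> y0 \<le> - c"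
    using strict_max_gap by blast
  \<comment> \<open>In order, the bounds provide \<open>\<alpha>1\<close>, keep T within its half of
    the ball, put \<open>\<alpha>1\<close> inside the sphere, and keep values on the sphere below
    the value at \<open>\<alpha>1\<close>.\<close>
  define \<delta> where "\<delta> = min (min d r) (min (r / (\<bar>B\<bar> + 1)) (c / (2 * \<bar>?s\<bar> + \<epsilon>)))"
  have pos: "\<bar>B\<bar> + 1 > 0" "2 * \<bar>?s\<bar> + \<epsilon> > 0" using \<epsilon> by (simp_all add: add_nonneg_pos)
  have "\<delta> > 0" using d(1) r c(1) pos by (simp add: \<delta>_def)
  moreover have "A_defined M T ?X \<and>
      \<bar>A_pot M T ?X - A_pot M T0 ?X - - ?s * (T - T0)\<bar> \<le> \<epsilon> * \<bar>T - T0\<bar>"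
    if T: "\<bar>T - T0\<bar> < \<delta>" for T
  proof -
    have Tr: "\<bar>T - T0\<bar> < d" "\<bar>T - T0\<bar> < r" using T by (simp_all add: \<delta>_def)
    have Tb: "(\<bar>B\<bar> + 1) * \<bar>T - T0\<bar> < r" "(2 * \<bar>?s\<bar> + \<epsilon>) * \<bar>T - T0\<bar> < c"
      using T pos by (simp_all add: \<delta>_def pos_less_divide_eq mult.commute)
    obtain \<alpha>1 where \<alpha>1: "(T, \<alpha>1) \<in> C" "(\<alpha>1 - \<alpha>0) \<bullet> ?X = - ?s * (T - T0) - \<epsilon> * \<bar>T - T0\<bar>"
      "dist \<alpha>0 \<alpha>1 \<le> B * \<bar>T - T0\<bar>"
      using d(2)[OF Tr(1)] by blast
    have "B * \<bar>T - T0\<bar> \<le> (\<bar>B\<bar> + 1) * \<bar>T - T0\<bar>"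
      by (intro mult_right_mono) auto
    then have \<alpha>1r: "dist \<alpha>0 \<alpha>1 < r" using \<alpha>1(3) Tb(1) by linarith
    let ?C = "{\<alpha>. (T, \<alpha>) \<in> C}"
    have sph: "q \<bullet> ?X < \<alpha>1 \<bullet> ?X" if q: "q \<in> ?C" "dist \<alpha>0 q = r" for q
    proof -
      have "(T, q) \<in> K" using q inball[of T q] Tr by (simp add: K_def)
      from c(2)[OF this] have 1: "?s * (T - T0) + (q - \<alpha>0) \<bullet> ?X \<le> - c"
        by (simp add: mult.commute)
      have 2: "\<bar>?s * (T - T0)\<bar> = \<bar>?s\<bar> * \<bar>T - T0\<bar>" by (rule abs_mult)
      have 3: "2 * (\<bar>?s\<bar> * \<bar>T - T0\<bar>) + \<epsilon> * \<bar>T - T0\<bar> < c"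
        using Tb(2) by (simp add: distrib_right)
      have "0 \<le> \<bar>?s\<bar> * \<bar>T - T0\<bar>" by simp
      then have "(q - \<alpha>0) \<bullet> ?X < (\<alpha>1 - \<alpha>0) \<bullet> ?X"
        using 1 2 3 \<alpha>1(2) by linarith
      then show ?thesis by (simp add: inner_diff_left)
    qed
    obtain m where m: "m \<in> ?C" "dist \<alpha>0 m < r" "\<And>p. p \<in> ?C \<Longrightarrow> p \<bullet> ?X \<le> m \<bullet> ?X"
    proof (rule inner_max_on_sublevel[of \<alpha>1 ?C \<alpha>0 r ?X])
      show "\<alpha>1 \<in> ?C" "dist \<alpha>0 \<alpha>1 < r" using \<alpha>1 \<alpha>1r by auto
      show "compact (?C \<inter> cball \<alpha>0 r)" using Tr by (intro compact_slice) (simp add: r_def)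
      show "q \<in> ?C" if "p \<in> ?C" "q \<in> closed_segment \<alpha>1 p" "q \<in> cball \<alpha>0 r" for p q
      proof -
        have "(T, q) \<in> closed_segment (T, \<alpha>1) (T, p)"
          using that(2) by (auto simp: in_segment algebra_simps)
        then show ?thesis
          using sublevel_segment[OF \<alpha>1(1), of "(T, p)" "(T, q)"] that(1,3) inball[of T q] Tr by simp
      qed
    qed (use sph in auto)
    have Zm: "Z (T, m) = 1"
    proof (rule ccontr)
      assume "Z (T, m) \<noteq> 1"
      moreover have "dist p0 (T, m) < R"
        using dist_Pair_le[of T0 \<alpha>0 T m] Tr m(2) by (simp add: r_def dist_real_def abs_minus_commute)
      ultimately obtain t where "t > 0" "(T, m) + t *\<^sub>R (0, ?X) \<in> C"
        using sublevel_room[of "(T, m)" "(0, ?X)"] m(1) Xbar_Y by auto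
      then have "t * (?X \<bullet> ?X) \<le> 0" using m(3)[of "m + t *\<^sub>R ?X"] by (simp add: inner_add_left)
      moreover have "0 < t * (?X \<bullet> ?X)"
        using \<open>t > 0\<close> X by (intro mult_pos_pos) auto
      ultimately show False by linarith
    qed
    have "A_defined M T ?X" "A_pot M T ?X = m \<bullet> ?X"
      using A_pot_eq[of T m ?X] m Zm Xbar_Y by auto
    moreover have "A_pot M T0 ?X = \<alpha>0 \<bullet> ?X"
      unfolding A_pot_at by (simp add: dot_eq_inner Xbar_outside)
    \<comment> \<open>The upper estimate uses that \<open>p0\<close> is optimal for
      \<open>y0\<close> on all of \<open>C\<close>; the lower one compares \<open>m\<close> with
      \<open>\<alpha>1\<close>.\<close>
    moreover have "((T, m) - p0) \<bullet> y0 \<le> 0"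
      using strict_max[of "(T, m)"] m(1) by (cases "(T, m) = p0") auto
    then have "m \<bullet> ?X - \<alpha>0 \<bullet> ?X \<le> - ?s * (T - T0)"
      by (simp add: inner_diff_left mult.commute)
    moreover have "- ?s * (T - T0) - \<epsilon> * \<bar>T - T0\<bar> \<le> m \<bullet> ?X - \<alpha>0 \<bullet> ?X"
      using m(3)[of \<alpha>1] \<alpha>1(1,2) by (simp add: inner_diff_left)
    moreover have "0 \<le> \<epsilon> * \<bar>T - T0\<bar>" using \<epsilon> by simp
    ultimately show ?thesis by (auto simp: abs_le_iff)
  qed
  ultimately show "\<exists>\<delta>>0. \<forall>T. \<bar>T - T0\<bar> < \<delta> \<longrightarrow> A_defined M T ?X \<and>
      \<bar>A_pot M T ?X - A_pot M T0 ?X - - ?s * (T - T0)\<bar> \<le> \<epsilon> * \<bar>T - T0\<bar>"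
    by blast
qed

end

section \<open>The second law\<close>

context thermal_system
begin

text \<open>Bounding each feasible value separately gives content even where the maximum does not
  exist.\<close>

lemma U_values_le:
  assumes "gibbs_state M S" "has_values M S" "u \<in> U_values M (Sbar M S) (Xbar M S)"
  shows "u \<le> Hbar M S"
    and "u = Hbar M S \<Longrightarrow> \<exists>T \<alpha>. T > 0 \<and> thermal_state M T \<alpha> S"
proof -
  obtain T \<alpha> where u: "u = T * Sbar M S + dot M \<alpha> (Xbar M S)"
    and dom: "(T, \<alpha>) \<in> Delta_dom M" "T > 0" "Delta M T \<alpha> = 0"
    using assms(3) unfolding U_values_def by blast
  then have Z: "partition_function M T \<alpha> \<le> 1" by (simp add: Delta_eq_0_iff)
  show "u \<le> Hbar M S" using value_le(1)[OF assms(1,2) dom(1,2) Z] by (simp add: u)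
  assume "u = Hbar M S"
  then have "S = thermal_entropy M T \<alpha>"
    using value_le(2)[OF assms(1,2) dom(1,2) Z] by (simp add: u)
  then show "\<exists>T \<alpha>. T > 0 \<and> thermal_state M T \<alpha> S"
    using assms(1) dom(2) unfolding thermal_state_def by blast
qed

lemma A_values_le:
  assumes "gibbs_state M S" "has_values M S" "T > 0" "u \<in> A_values M T (Xbar M S)"
  shows "u \<le> Hbar M S - T * Sbar M S"
    and "u = Hbar M S - T * Sbar M S \<Longrightarrow> \<exists>\<alpha>. thermal_state M T \<alpha> S"
proof -
  obtain \<alpha> where u: "u = dot M \<alpha> (Xbar M S)"
    and dom: "(T, \<alpha>) \<in> Delta_dom M" "Delta M T \<alpha> = 0"
    using assms(4) unfolding A_values_def by blast
  then have Z: "partition_function M T \<alpha> \<le> 1" by (simp add: Delta_eq_0_iff)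
  show "u \<le> Hbar M S - T * Sbar M S"
    using value_le(1)[OF assms(1,2) dom(1) assms(3) Z] by (simp add: u)
  assume "u = Hbar M S - T * Sbar M S"
  then have "S = thermal_entropy M T \<alpha>"
    using value_le(2)[OF assms(1,2) dom(1) assms(3) Z] by (simp add: u)
  then show "\<exists>\<alpha>. thermal_state M T \<alpha> S"
    using assms(1,3) unfolding thermal_state_def by blast
qed

lemma thermal_U_value:
  assumes "thermal_state M T \<alpha> S" "T > 0"
  shows "T * s + dot M \<alpha> x \<in> U_values M s x"
  using thermal_stateD(4,6)[OF assms(1)] assms(2) unfolding U_values_def by blast

lemma thermal_A_value:
  assumes "thermal_state M T \<alpha> S"
  shows "dot M \<alpha> x \<in> A_values M T x"
  using thermal_stateD(4,6)[OF assms(1)] unfolding A_values_def by blast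

text \<open>The state's own parameters are feasible and attain the general upper bound
  \<open>Hbar M S\<close>; so the maximum exists here without any compactness.\<close>

lemma thermal_U_pot:
  assumes "thermal_state M T \<alpha> S" "has_values M S" "T > 0"
  shows "U_defined M (Sbar M S) (Xbar M S)" "U_pot M (Sbar M S) (Xbar M S) = Hbar M S"
proof -
  have "Hbar M S \<in> U_values M (Sbar M S) (Xbar M S)"
    using thermal_U_value[OF assms(1,3), of "Sbar M S" "Xbar M S"] thermal_euler[OF assms(1,2)] by simp
  then show "U_defined M (Sbar M S) (Xbar M S)" "U_pot M (Sbar M S) (Xbar M S) = Hbar M S"
    unfolding U_defined_def U_pot_def
    using maximumI U_values_le(1)[OF thermal_stateD(1)[OF assms(1)] assms(2)] by metis+
qed

lemma thermal_A_pot: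
  assumes "thermal_state M T \<alpha> S" "has_values M S" "T > 0"
  shows "A_defined M T (Xbar M S)" "A_pot M T (Xbar M S) = Hbar M S - T * Sbar M S"
proof -
  have "Hbar M S - T * Sbar M S \<in> A_values M T (Xbar M S)"
    unfolding thermal_euler[OF assms(1,2), symmetric] using thermal_A_value[OF assms(1)] by simp
  then show "A_defined M T (Xbar M S)" "A_pot M T (Xbar M S) = Hbar M S - T * Sbar M S"
    unfolding A_defined_def A_pot_def
    using maximumI A_values_le(1)[OF thermal_stateD(1)[OF assms(1)] assms(2,3)] by metis+
qed

lemma U_derivatives_unique:
  assumes t: "thermal_state M T \<alpha> S" and v: "has_values M S" and T: "T > 0"
  shows "dU_dS M (Sbar M S) (Xbar M S) D \<Longrightarrow> T = D"
    and "j \<in> Idx M \<Longrightarrow> dU_dX M j (Sbar M S) (Xbar M S) D \<Longrightarrow> \<alpha> $ j = D"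
proof -
  have le: "T * s + dot M \<alpha> x \<le> U_pot M s x" if "U_defined M s x" for s x
    using maximumD(2) thermal_U_value[OF t T] that unfolding U_defined_def U_pot_def by blast
  have at: "U_pot M (Sbar M S) (Xbar M S) = T * Sbar M S + dot M \<alpha> (Xbar M S)"
    using thermal_U_pot(2)[OF t v T] thermal_euler[OF t v] by simp
  show "T = D" if "dU_dS M (Sbar M S) (Xbar M S) D"
    using that unfolding dU_dS_def
    by (rule partial_deriv_support[symmetric, where e = 1]) (use le in \<open>auto simp: at algebra_simps\<close>)
  show "\<alpha> $ j = D" if j: "j \<in> Idx M" and D: "dU_dX M j (Sbar M S) (Xbar M S) D"
    using D unfolding dU_dX_def
  proof (rule partial_deriv_support[symmetric, where e = 1])
    fix y assume "U_defined M (Sbar M S) (vec_upd (Xbar M S) j y)"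
    from le[OF this] show "U_pot M (Sbar M S) (vec_upd (Xbar M S) j (Xbar M S $ j)) +
        \<alpha> $ j * (y - Xbar M S $ j) \<le> U_pot M (Sbar M S) (vec_upd (Xbar M S) j y)"
      by (simp add: vec_upd_self at dot_vec_upd[OF j])
  qed simp
qed

text \<open>In X, the fixed \<alpha> stays feasible and gives a supporting line from below. When T
  varies it need not, and the line \<open>Hbar M S - T' * Sbar M S\<close> supports from above
  instead; hence the change of sign.\<close>

lemma A_derivatives_unique:
  assumes t: "thermal_state M T \<alpha> S" and v: "has_values M S" and T: "T > 0"
  shows "dA_dT M T (Xbar M S) D \<Longrightarrow> Sbar M S = - D"
    and "j \<in> Idx M \<Longrightarrow> dA_dX M j T (Xbar M S) D \<Longrightarrow> \<alpha> $ j = D"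
proof -
  have le: "dot M \<alpha> x \<le> A_pot M T x" if "A_defined M T x" for x
    using maximumD(2) thermal_A_value[OF t] that unfolding A_defined_def A_pot_def by blast
  have at: "A_pot M T (Xbar M S) = Hbar M S - T * Sbar M S" "A_pot M T (Xbar M S) = dot M \<alpha> (Xbar M S)"
    using thermal_A_pot(2)[OF t v T] thermal_euler[OF t v] by (simp_all add: algebra_simps)
  show "Sbar M S = - D" if "dA_dT M T (Xbar M S) D"
  proof -
    have "- D = Sbar M S"
      \<comment> \<open>Taking T as the radius keeps \<open>T'\<close> positive.\<close>
      using partial_deriv_minus[OF that[unfolded dA_dT_def]] T
    proof (rule partial_deriv_support)
      fix T' assume T': "\<bar>T' - T\<bar> < T" and "A_defined M T' (Xbar M S)"
      then have "A_pot M T' (Xbar M S) \<in> A_values M T' (Xbar M S)"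
        using maximumD(1) unfolding A_defined_def A_pot_def by blast
      then have "A_pot M T' (Xbar M S) \<le> Hbar M S - T' * Sbar M S"
        using A_values_le(1)[OF thermal_stateD(1)[OF t] v] T' by auto
      then show "- A_pot M T (Xbar M S) + Sbar M S * (T' - T) \<le> - A_pot M T' (Xbar M S)"
        by (simp add: at(1) algebra_simps)
    qed
    then show ?thesis by simp
  qed
  show "\<alpha> $ j = D" if j: "j \<in> Idx M" and D: "dA_dX M j T (Xbar M S) D"
    using D unfolding dA_dX_def
  proof (rule partial_deriv_support[symmetric, where e = 1])
    fix y assume "A_defined M T (vec_upd (Xbar M S) j y)"
    from le[OF this] show "A_pot M T (vec_upd (Xbar M S) j (Xbar M S $ j)) +
        \<alpha> $ j * (y - Xbar M S $ j) \<le> A_pot M T (vec_upd (Xbar M S) j y)"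
      by (simp add: vec_upd_self at(2) dot_vec_upd[OF j])
  qed simp
qed

lemma derivatives_exist:
  assumes t: "thermal_state M T \<alpha> S" and v: "has_values M S" and T: "T > 0"
    and reg: "independent_variables M" "regular_at M T \<alpha>"
  shows "dU_dS M (Sbar M S) (Xbar M S) T"
    and "j \<in> Idx M \<Longrightarrow> dU_dX M j (Sbar M S) (Xbar M S) (\<alpha> $ j)"
    and "Xbar M S \<noteq> 0 \<Longrightarrow> dA_dT M T (Xbar M S) (- Sbar M S)"
    and "j \<in> Idx M \<Longrightarrow> dA_dX M j T (Xbar M S) (\<alpha> $ j)"
proof -
  obtain R where "regular_ball M (T, \<alpha>) R"
    using regular_ball_exists[OF reg(2) T] .
  then interpret regular_thermal_state M S T \<alpha> R
    using t v T reg(1) by unfold_locales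
  show "dU_dS M (Sbar M S) (Xbar M S) T" by (rule dU_dS_thermal)
  show "dU_dX M j (Sbar M S) (Xbar M S) (\<alpha> $ j)" if "j \<in> Idx M" using that by (rule dU_dX_thermal)
  show "dA_dT M T (Xbar M S) (- Sbar M S)" if "Xbar M S \<noteq> 0" using that by (rule dA_dT_thermal)
  show "dA_dX M j T (Xbar M S) (\<alpha> $ j)" if "j \<in> Idx M" using that by (rule dA_dX_thermal)
qed

text \<open>The parameters of the first state are tried on the second: equal potentials give
  equality in Gibbs' inequality, so the second has the entropy of the first.\<close>

lemma thermal_state_unique_S_X:
  assumes "T > 0" "T' > 0" "thermal_state M T \<alpha> S" "thermal_state M T' \<alpha>' S'"
    "has_values M S" "has_values M S'" "Sbar M S = Sbar M S'" "Xbar M S = Xbar M S'"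
  shows "S = S'"
proof -
  note d = thermal_stateD[OF assms(3)] and d' = thermal_stateD[OF assms(4)]
  have "Hbar M S = Hbar M S'"
    using thermal_U_pot(2)[OF assms(3,5,1)] thermal_U_pot(2)[OF assms(4,6,2)] assms(7,8) by simp
  then have "S' = thermal_entropy M T \<alpha>"
    using value_le(2)[OF d'(1) assms(6) d(4) assms(1)] d(5) thermal_euler[OF assms(3,5)] assms(7,8) by simp
  then show ?thesis using d(3) by simp
qed

text \<open>The two energies and mean entropies could differ a priori; the Helmholtz potential fixes
  only the difference H - TS, which suffices for the equality case.\<close>

lemma thermal_state_unique_T_X:
  assumes "T > 0" "thermal_state M T \<alpha> S" "thermal_state M T \<alpha>' S'"
    "has_values M S" "has_values M S'" "Xbar M S = Xbar M S'"
  shows "S = S'"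
proof -
  note d = thermal_stateD[OF assms(2)] and d' = thermal_stateD[OF assms(3)]
  have "dot M \<alpha> (Xbar M S) = dot M \<alpha>' (Xbar M S')"
    using thermal_A_pot(2)[OF assms(2,4,1)] thermal_A_pot(2)[OF assms(3,5,1)]
      thermal_euler[OF assms(2,4)] thermal_euler[OF assms(3,5)] assms(6) by simp
  then have "S' = thermal_entropy M T \<alpha>"
    using value_le(2)[OF d'(1) assms(5) d(4) assms(1)] d(5) thermal_euler[OF assms(3,5)] assms(6) by simp
  then show ?thesis using d(3) by simp
qed

end

theorem theorem11p1:
  fixes M :: "('e::ring_1, 'j::finite) thermal"
  assumes "thermal_system M"
  shows
    \<comment> \<open>(i)\<close>
    "(\<forall>S. gibbs_state M S \<and> has_values M S \<longrightarrow>
        (\<forall>u\<in>U_values M (Sbar M S) (Xbar M S). Hbar M S \<ge> u) \<and>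
        (U_defined M (Sbar M S) (Xbar M S) \<longrightarrow> Hbar M S \<ge> U_pot M (Sbar M S) (Xbar M S)) \<and>
        (U_defined M (Sbar M S) (Xbar M S) \<and> Hbar M S = U_pot M (Sbar M S) (Xbar M S)
           \<longleftrightarrow> (\<exists>T \<alpha>. T > 0 \<and> thermal_state M T \<alpha> S)) \<and>
        (\<forall>T \<alpha>. T > 0 \<and> thermal_state M T \<alpha> S \<longrightarrow>
           (\<forall>D. dU_dS M (Sbar M S) (Xbar M S) D \<longrightarrow> T = D) \<and>
           (\<forall>j\<in>Idx M. \<forall>D. dU_dX M j (Sbar M S) (Xbar M S) D \<longrightarrow> \<alpha> $ j = D) \<and>
           (independent_variables M \<and> regular_at M T \<alpha> \<longrightarrow>
              dU_dS M (Sbar M S) (Xbar M S) T \<and>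
              (\<forall>j\<in>Idx M. dU_dX M j (Sbar M S) (Xbar M S) (\<alpha> $ j))) \<and>
           T * Sbar M S + dot M \<alpha> (Xbar M S) = Hbar M S \<and>
           Hbar M S = U_pot M (Sbar M S) (Xbar M S))) \<and>
     (\<forall>S S' T T' \<alpha> \<alpha>'. T > 0 \<and> T' > 0 \<and> thermal_state M T \<alpha> S \<and> thermal_state M T' \<alpha>' S' \<and>
        has_values M S \<and> has_values M S' \<and> Sbar M S = Sbar M S' \<and> Xbar M S = Xbar M S'
        \<longrightarrow> S = S') \<and>
     \<comment> \<open>(ii)\<close>
     (\<forall>T > 0. \<forall>S. gibbs_state M S \<and> has_values M S \<longrightarrow>
        (\<forall>u\<in>A_values M T (Xbar M S). Hbar M S - T * Sbar M S \<ge> u) \<and>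
        (A_defined M T (Xbar M S) \<longrightarrow> Hbar M S - T * Sbar M S \<ge> A_pot M T (Xbar M S)) \<and>
        (A_defined M T (Xbar M S) \<and> Hbar M S - T * Sbar M S = A_pot M T (Xbar M S)
           \<longleftrightarrow> (\<exists>\<alpha>. thermal_state M T \<alpha> S)) \<and>
        (\<forall>\<alpha>. thermal_state M T \<alpha> S \<longrightarrow>
           (\<forall>D. dA_dT M T (Xbar M S) D \<longrightarrow> Sbar M S = - D) \<and>
           (\<forall>j\<in>Idx M. \<forall>D. dA_dX M j T (Xbar M S) D \<longrightarrow> \<alpha> $ j = D) \<and>
           (independent_variables M \<and> regular_at M T \<alpha> \<longrightarrow>
              (Xbar M S \<noteq> 0 \<longrightarrow> dA_dT M T (Xbar M S) (- Sbar M S)) \<and>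
              (\<forall>j\<in>Idx M. dA_dX M j T (Xbar M S) (\<alpha> $ j))) \<and>
           Hbar M S = T * Sbar M S + dot M \<alpha> (Xbar M S) \<and>
           Hbar M S = A_pot M T (Xbar M S) + T * Sbar M S)) \<and>
     (\<forall>T > 0. \<forall>S S' \<alpha> \<alpha>'. thermal_state M T \<alpha> S \<and> thermal_state M T \<alpha>' S' \<and>
        has_values M S \<and> has_values M S' \<and> Xbar M S = Xbar M S'
        \<longrightarrow> S = S')"
proof -
  interpret thermal_system M by (rule assms)
  have U: "U_pot M (Sbar M S) (Xbar M S) \<in> U_values M (Sbar M S) (Xbar M S)"
    if "U_defined M (Sbar M S) (Xbar M S)" for S
    using maximumD(1) that unfolding U_defined_def U_pot_def by blast
  have A: "A_pot M T (Xbar M S) \<in> A_values M T (Xbar M S)" if "A_defined M T (Xbar M S)" for S T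
    using maximumD(1) that unfolding A_defined_def A_pot_def by blast
  show ?thesis
    apply (intro conjI allI impI ballI iffI)
    subgoal using U_values_le(1) by blast
    subgoal using U_values_le(1) U by blast
    subgoal using U_values_le(2) U by metis
    subgoal using thermal_U_pot(1) by blast
    subgoal using thermal_U_pot(2) by metis
    subgoal using U_derivatives_unique(1) by blast
    subgoal using U_derivatives_unique(2) by blast
    subgoal using derivatives_exist(1) by blast
    subgoal using derivatives_exist(2) by blast
    subgoal using thermal_euler by blast
    subgoal using thermal_U_pot(2) by metis
    subgoal using thermal_state_unique_S_X by blast
    subgoal using A_values_le(1) by blast
    subgoal using A_values_le(1) A by blast
    subgoal using A_values_le(2) A by metis
    subgoal using thermal_A_pot(1) by blast
    subgoal using thermal_A_pot(2) by metis
    subgoal using A_derivatives_unique(1) by blast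
    subgoal using A_derivatives_unique(2) by blast
    subgoal using derivatives_exist(3) by blast
    subgoal using derivatives_exist(4) by blast
    subgoal using thermal_euler by metis
    subgoal using thermal_A_pot(2) by (metis diff_add_cancel)
    subgoal using thermal_state_unique_T_X by blast
    done
qed

end
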